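(* Let $F\in C^2(\Omega)$ and let $u:[t_0,T]\to\mathbb{R}$ be a solution of $u'(t)=F(t,u(t))$, $t\in(t_0,T)$, $u(t_0)=u_0$. Suppose that there exist constants $H>0$ and $\eta>0$ such that, for every $h\in(0,H]$, a sequence $\{\sigma_n\}_{n=0}^{N_h-1}$ of positive scales (which may depend on $h$) is given such that $\sigma_n^2+u'(t_n)^2\ge\eta$ for every $n=0,1,\ldots,N_h-1$. Let $\ell_{n+1}$ denote the corresponding local truncation errors. (a) If $u\in C^3([t_0,T])$, then $$\ell_{n+1}=-\frac{h^2}{12}\,\sigma_n\left\|\gamma_{\sigma_n}'(t_n)\right\|^3\kappa_{\sigma_n}'(t_n)+R_{n+1}(h),$$ where there exists a function $\omega:(0,H]\to[0,\infty)$ such that $\omega(h)\to0$ as $h\searrow0$ and $|R_{n+1}(h)|\le\omega(h)h^2$ whenever $0<h\le H$ and $t_{n+1}\le T$. (b) If $u\in C^4([t_0,T])$, then $$\ell_{n+1}=-\frac{h^2}{12}\,\sigma_n\left\|\gamma_{\sigma_n}'(t_n)\right\|^3\kappa_{\sigma_n}'(t_n)+R_{n+1}(h),$$ where there exists a constant $C>0$, independent of $h$ and $n$, such that $|R_{n+1}(h)|\le Ch^3$ whenever $h>0$ is sufficiently small and $t_{n+1}\le T$. (c) If $u\in C^5([t_0,T])$, then $$\ell_{n+1}=-\frac{h^2}{24}\,\sigma_n\left[\left\|\gamma_{\sigma_n}'(t_n)\right\|^3\kappa_{\sigma_n}'(t_n)+\left\|\gamma_{\sigma_n}'(t_{n+1})\right\|^3\kappa_{\sigma_n}'(t_{n+1})\right]+R_{n+1}(h),$$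 where there exists a constant $C>0$, independent of $h$ and $n$, such that $|R_{n+1}(h)|\le Ch^4$ whenever $h>0$ is sufficiently small and $t_{n+1}\le T$.
   Context: Let $\Omega\subset\mathbb{R}^2$ be open, $F:\Omega\to\mathbb{R}$, $t_0\ge 0$, $T>t_0$, $u_0\in\mathbb{R}$ with $(t_0,u_0)\in\Omega$. A solution $u:[t_0,T]\to\mathbb{R}$ satisfies $(t,u(t))\in\Omega$ for every $t\in[t_0,T]$. For $h>0$ put $N_h:=\lfloor h^{-1}(T-t_0)\rfloor$ and $t_n:=t_0+nh$. "Sufficiently small" means for all $h\in(0,h_0]$ with some $h_0\in(0,H]$ not depending on $n$. For $\sigma>0$ define $\mathcal{C}_\sigma(\alpha,\beta):=\sigma\,\mathcal{C}(\alpha/\sigma,\beta/\sigma)$, where $$\mathcal{C}(\alpha,\beta):=\left(\frac{\alpha}{\sqrt{1+\alpha^2}}+\frac{\beta}{\sqrt{1+\beta^2}}\right)\left(\frac{1}{\sqrt{1+\alpha^2}}+\frac{1}{\sqrt{1+\beta^2}}\right)^{-1}.$$ The local truncation error of the specular ellipse method with scales $\{\sigma_n\}$ is $$\ell_{n+1}:=\frac{u(t_{n+1})-u(t_n)}{h}-\mathcal{C}_{\sigma_n}\bigl(F(t_{n+1},u(t_{n+1})),F(t_n,u(t_n))\bigr),\qquad n=0,\ldots,N_h-1.$$ For $\sigma>0$ and $t\in[t_0,T]$: $\gamma_\sigma(t):=(t,u(t)/\sigma)$, so that $\|\gamma_\sigma'(t)\|=\sqrt{1+u'(t)^2/\sigma^2}$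 (Euclidean norm), and the signed curvature is $\kappa_\sigma(t):=\dfrac{\sigma^2u''(t)}{(\sigma^2+u'(t)^2)^{3/2}}$; $\kappa_\sigma'$ is its derivative in $t$ (one-sided at the endpoints). *)

theory Defs
  imports "HOL-Analysis.Analysis"
begin

text \<open>Derivatives on an interval \<open>S\<close> are taken within \<open>S\<close>, so that they are one-sided at endpoints
  that belong to \<open>S\<close> and do not depend on values outside \<open>S\<close>.\<close>

definition deriv_within :: "real set \<Rightarrow> (real \<Rightarrow> 'a::real_normed_vector) \<Rightarrow> real \<Rightarrow> 'a" where
  "deriv_within S f t = vector_derivative f (at t within S)"

definition C_k_on :: "nat \<Rightarrow> real set \<Rightarrow> (real \<Rightarrow> real) \<Rightarrow> bool" where
  "C_k_on k S f \<longleftrightarrow>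
     (\<forall>i<k. \<forall>t\<in>S. (deriv_within S ^^ i) f differentiable (at t within S)) \<and>
     continuous_on S ((deriv_within S ^^ k) f)"

definition partial1 :: "(real \<times> real \<Rightarrow> real) \<Rightarrow> real \<times> real \<Rightarrow> real" where
  "partial1 F = (\<lambda>(t, y). deriv (\<lambda>s. F (s, y)) t)"

definition partial2 :: "(real \<times> real \<Rightarrow> real) \<Rightarrow> real \<times> real \<Rightarrow> real" where
  "partial2 F = (\<lambda>(t, y). deriv (\<lambda>z. F (t, z)) y)"

text \<open>\<open>C\<^sup>k\<close> on an open subset of the plane: all partial derivatives of order at most \<open>k\<close> exist and are
  continuous.\<close>

primrec C_k_plane :: "nat \<Rightarrow> (real \<times> real) set \<Rightarrow> (real \<times> real \<Rightarrow> real) \<Rightarrow> bool" where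
  "C_k_plane 0 \<Omega> F \<longleftrightarrow> continuous_on \<Omega> F"
| "C_k_plane (Suc k) \<Omega> F \<longleftrightarrow>
     continuous_on \<Omega> F \<and>
     (\<forall>(t, y)\<in>\<Omega>. (\<lambda>s. F (s, y)) differentiable (at t) \<and> (\<lambda>z. F (t, z)) differentiable (at y)) \<and>
     C_k_plane k \<Omega> (partial1 F) \<and> C_k_plane k \<Omega> (partial2 F)"

definition ivp_solution ::
  "(real \<times> real) set \<Rightarrow> (real \<times> real \<Rightarrow> real) \<Rightarrow> real \<Rightarrow> real \<Rightarrow> real \<Rightarrow> (real \<Rightarrow> real) \<Rightarrow> bool" where
  "ivp_solution \<Omega> F t0 T u0 u \<longleftrightarrow>
     continuous_on {t0..T} u \<and>
     (\<forall>t\<in>{t0..T}. (t, u t) \<in> \<Omega>) \<and>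
     (\<forall>t\<in>{t0<..<T}. (u has_real_derivative F (t, u t)) (at t)) \<and>
     u t0 = u0"

definition num_steps :: "real \<Rightarrow> real \<Rightarrow> real \<Rightarrow> nat" where
  "num_steps t0 T h = nat \<lfloor>(T - t0) / h\<rfloor>"

definition grid :: "real \<Rightarrow> real \<Rightarrow> nat \<Rightarrow> real" where
  "grid t0 h n = t0 + real n * h"

definition spec_C :: "real \<Rightarrow> real \<Rightarrow> real" where
  "spec_C \<alpha> \<beta> =
     (\<alpha> / sqrt (1 + \<alpha>\<^sup>2) + \<beta> / sqrt (1 + \<beta>\<^sup>2)) *
     inverse (1 / sqrt (1 + \<alpha>\<^sup>2) + 1 / sqrt (1 + \<beta>\<^sup>2))"

definition spec_C_scaled :: "real \<Rightarrow> real \<Rightarrow> real \<Rightarrow> real" where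
  "spec_C_scaled s \<alpha> \<beta> = s * spec_C (\<alpha> / s) (\<beta> / s)"

text \<open>\<open>local_trunc_err F u t0 h s n\<close> is \<open>\<ell>\<^bsub>n+1\<^esub>\<close> for step size \<open>h\<close>, where \<open>s\<close> is the scale \<open>\<sigma>\<^sub>n\<close>.\<close>

definition local_trunc_err ::
  "(real \<times> real \<Rightarrow> real) \<Rightarrow> (real \<Rightarrow> real) \<Rightarrow> real \<Rightarrow> real \<Rightarrow> real \<Rightarrow> nat \<Rightarrow> real" where
  "local_trunc_err F u t0 h s n =
     (u (grid t0 h (n + 1)) - u (grid t0 h n)) / h -
     spec_C_scaled s (F (grid t0 h (n + 1), u (grid t0 h (n + 1))))
                     (F (grid t0 h n, u (grid t0 h n)))"

definition scaled_curve :: "(real \<Rightarrow> real) \<Rightarrow> real \<Rightarrow> real \<Rightarrow> real \<times> real" where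
  "scaled_curve u s t = (t, u t / s)"

definition curve_speed :: "real \<Rightarrow> real \<Rightarrow> (real \<Rightarrow> real) \<Rightarrow> real \<Rightarrow> real \<Rightarrow> real" where
  "curve_speed t0 T u s t = norm (deriv_within {t0..T} (scaled_curve u s) t)"

definition curvature :: "real \<Rightarrow> real \<Rightarrow> (real \<Rightarrow> real) \<Rightarrow> real \<Rightarrow> real \<Rightarrow> real" where
  "curvature t0 T u s t =
     s\<^sup>2 * (deriv_within {t0..T} ^^ 2) u t /
     (s\<^sup>2 + (deriv_within {t0..T} u t)\<^sup>2) powr (3 / 2)"

definition curvature_deriv :: "real \<Rightarrow> real \<Rightarrow> (real \<Rightarrow> real) \<Rightarrow> real \<Rightarrow> real \<Rightarrow> real" where
  "curvature_deriv t0 T u s = deriv_within {t0..T} (curvature t0 T u s)"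

end

theory Submission
  imports Defs "HOL-Library.Landau_Symbols"
begin

text \<open>With \<open>A = sqrt (\<sigma>\<^sup>2 + \<alpha>\<^sup>2)\<close> and \<open>B = sqrt (\<sigma>\<^sup>2 + \<beta>\<^sup>2)\<close> the scaled mean is the arithmetic mean of \<open>\<alpha>\<close> and
  \<open>\<beta>\<close> minus the defect \<open>(\<alpha> - \<beta>)\<^sup>2 (\<alpha> + \<beta>) / (2 (A + B)\<^sup>2)\<close>. Hence the local truncation error is the error of
  the trapezoidal rule, in which the scale does not occur, plus this defect at \<open>\<alpha> = u'(t\<^bsub>n+1\<^esub>)\<close> and
  \<open>\<beta> = u'(t\<^sub>n)\<close>. Since \<open>\<sigma> \<parallel>\<gamma>'\<parallel>\<^sup>3 \<kappa>' = u''' - 3 u' u''\<^sup>2 / (\<sigma>\<^sup>2 + u'\<^sup>2)\<close>, the term \<open>u'''\<close> cancels against the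
  Taylor expansion of the trapezoidal error and the quotient against that of the defect. The latter is
  uniform in \<open>\<sigma>\<close>: the square root is 1-Lipschitz, so \<open>\<bar>A - B\<bar> \<le> \<bar>\<alpha> - \<beta>\<bar>\<close>, and the reciprocals are bounded
  by means of \<open>\<eta>\<close>.\<close>

section \<open>The specular mean and its defect from the arithmetic mean\<close>

text \<open>Orders are tracked as literal powers of \<open>h\<close>, with bounded quantities
  counted as \<open>h x ^ 0\<close>, so one product rule serves throughout. The exponent equation is
  a separate premise because a goal such as \<open>h x ^ 3\<close> does not unify with a sum of
  exponents.\<close>

lemma bigo_power_mult:
  fixes h :: "'a \<Rightarrow> real"
  assumes "f \<in> O[F](\<lambda>x. h x ^ i)" and "g \<in> O[F](\<lambda>x. h x ^ j)" and "k = i + j"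
  shows "(\<lambda>x. f x * g x) \<in> O[F](\<lambda>x. h x ^ k)"
  using landau_o.big_mult[OF assms(1,2)] by (simp add: assms(3) power_add)

lemma bigo_power_Suc_weaken:
  fixes h :: "'a \<Rightarrow> real"
  assumes "f \<in> O[F](\<lambda>x. h x ^ Suc i)" and h: "h \<in> O[F](\<lambda>_. 1)"
  shows "f \<in> O[F](\<lambda>x. h x ^ i)"
proof (rule landau_o.big_trans[OF assms(1)])
  show "(\<lambda>x. h x ^ Suc i) \<in> O[F](\<lambda>x. h x ^ i)"
    using landau_o.big_1_mult[OF landau_o.big_refl[of "\<lambda>x. h x ^ i"] h] by (simp add: mult.commute)
qed

definition chord_defect :: "real \<Rightarrow> real \<Rightarrow> real \<Rightarrow> real" where
  "chord_defect s a b =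
     (a - b)\<^sup>2 * (a + b) / (2 * (sqrt (s\<^sup>2 + a\<^sup>2) + sqrt (s\<^sup>2 + b\<^sup>2))\<^sup>2)"

text \<open>The scaled mean is the weighted mean \<open>(a * B + b * A) / (A + B)\<close>. Its
  deviation from \<open>(a + b) / 2\<close> contains the factor \<open>B - A\<close>; multiplying by
  \<open>A + B\<close> turns this into a difference of squares, from which \<open>s\<close>
  cancels.\<close>

lemma spec_C_scaled_eq:
  assumes "s > 0"
  shows "spec_C_scaled s a b = (a + b) / 2 - chord_defect s a b"
proof -
  define A where "A = sqrt (s\<^sup>2 + a\<^sup>2)"
  define B where "B = sqrt (s\<^sup>2 + b\<^sup>2)"
  have A: "A > 0" "A\<^sup>2 = s\<^sup>2 + a\<^sup>2" and B: "B > 0" "B\<^sup>2 = s\<^sup>2 + b\<^sup>2"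
    using assms unfolding A_def B_def by (simp_all add: add_pos_nonneg)
  have scale: "sqrt (1 + (c / s)\<^sup>2) = sqrt (s\<^sup>2 + c\<^sup>2) / s" for c
  proof -
    have "1 + (c / s)\<^sup>2 = (s\<^sup>2 + c\<^sup>2) / s\<^sup>2"
      using assms by (simp add: field_simps)
    then show ?thesis
      using assms by (simp add: real_sqrt_divide)
  qed
  have "spec_C_scaled s a b = s * ((a / A + b / B) / (s / A + s / B))"
    unfolding spec_C_scaled_def spec_C_def scale A_def[symmetric] B_def[symmetric]
    using assms by (simp add: field_simps)
  also have "s / A + s / B = s * (A + B) / (A * B)"
    using A(1) B(1) by (simp add: field_simps)
  also have "a / A + b / B = (a * B + b * A) / (A * B)"
    using A(1) B(1) by (simp add: field_simps)
  also have "s * ((a * B + b * A) / (A * B) / (s * (A + B) / (A * B))) = (a * B + b * A) / (A + B)"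
    using assms A(1) B(1) by simp
  also have "\<dots> = (a + b) / 2 + (a - b) * (B - A) / (2 * (A + B))"
    using A(1) B(1) by (simp add: divide_simps) (simp add: algebra_simps)
  also have "(a - b) * (B - A) / (2 * (A + B)) = (a - b) * ((B - A) * (A + B)) / (2 * (A + B)\<^sup>2)"
    using A(1) B(1) by (simp add: power2_eq_square)
  also have "(B - A) * (A + B) = - ((a - b) * (a + b))"
    using A(2) B(2) by (simp add: algebra_simps power2_eq_square)
  finally show ?thesis
    unfolding chord_defect_def A_def[symmetric] B_def[symmetric]
    by (simp add: power2_eq_square mult.assoc)
qed

text \<open>The roots are Euclidean norms of the points \<open>(s, a)\<close> and
  \<open>(s, b)\<close>, so this is the reverse triangle inequality; the bound is free of
  \<open>s\<close>.\<close>

lemma sqrt_sum_squares_lipschitz: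
  "\<bar>sqrt (s\<^sup>2 + a\<^sup>2) - sqrt (s\<^sup>2 + b\<^sup>2)\<bar> \<le> \<bar>a - b\<bar>"
proof -
  have "\<bar>norm (s, a) - norm (s, b)\<bar> \<le> norm ((s, a) - (s, b))"
    by (rule norm_triangle_ineq3)
  then show ?thesis
    by (simp add: norm_Pair)
qed

text \<open>In the application \<open>p0\<close> and \<open>p1\<close> are the first derivatives at
  the two ends of a step and \<open>q\<close> is the second derivative at the left end. The defect
  is already quadratic in \<open>p1 - p0\<close>, hence of order \<open>h^2\<close>, and freezing
  every factor at the left end costs one further order.\<close>

lemma chord_defect_expansion:
  fixes h s p0 p1 q :: "'a \<Rightarrow> real"
  assumes "0 < \<eta>" and ev: "eventually (\<lambda>x. \<eta> \<le> (s x)\<^sup>2 + (p0 x)\<^sup>2) F"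
    and p0: "p0 \<in> O[F](\<lambda>_. 1)" and q: "q \<in> O[F](\<lambda>_. 1)" and h: "h \<in> O[F](\<lambda>_. 1)"
    and dq: "(\<lambda>x. p1 x - p0 x - h x * q x) \<in> O[F](\<lambda>x. h x ^ 2)"
  shows "(\<lambda>x. chord_defect (s x) (p1 x) (p0 x)
      - h x ^ 2 * (p0 x * (q x)\<^sup>2 / (4 * ((s x)\<^sup>2 + (p0 x)\<^sup>2)))) \<in> O[F](\<lambda>x. h x ^ 3)"
proof -
  define A where "A x = sqrt ((s x)\<^sup>2 + (p1 x)\<^sup>2)" for x
  define B where "B x = sqrt ((s x)\<^sup>2 + (p0 x)\<^sup>2)" for x
  define d where "d x = p1 x - p0 x" for x
  define v where "v x = 1 / (A x + B x)" for x
  define w where "w x = 1 / B x" for x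
  note mult = bigo_power_mult[where h = h]
  have p0': "p0 \<in> O[F](\<lambda>x. h x ^ 0)" and q': "q \<in> O[F](\<lambda>x. h x ^ 0)"
    and h': "h \<in> O[F](\<lambda>x. h x ^ 1)"
    using p0 q by simp_all
  have hq: "(\<lambda>x. h x * q x) \<in> O[F](\<lambda>x. h x ^ 1)"
    by (rule mult[OF h' q']) simp
  note weaken = bigo_power_Suc_weaken[OF _ h]
  have d: "d \<in> O[F](\<lambda>x. h x ^ 1)"
    unfolding d_def[abs_def]
    using sum_in_bigo(1)[OF weaken[OF dq[unfolded numeral_2_eq_2]] hq[unfolded One_nat_def]]
    by simp
  have AB: "(\<lambda>x. B x - A x) \<in> O[F](\<lambda>x. h x ^ 1)"
  proof (rule landau_o.big_trans[OF _ d], rule landau_o.bigI[of 1])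
    show "\<forall>\<^sub>F x in F. norm (B x - A x) \<le> 1 * norm (d x)"
      using sqrt_sum_squares_lipschitz by (simp add: A_def B_def d_def abs_minus_commute)
  qed simp
  have evB: "eventually (\<lambda>x. sqrt \<eta> \<le> B x) F"
    using ev by eventually_elim (simp add: B_def)
  have A_nonneg: "A x \<ge> 0" for x
    by (simp add: A_def)
  have w: "w \<in> O[F](\<lambda>x. h x ^ 0)"
  proof (rule landau_o.bigI[of "1 / sqrt \<eta>"])
    show "\<forall>\<^sub>F x in F. norm (w x) \<le> 1 / sqrt \<eta> * norm (h x ^ 0)"
      using evB
    proof eventually_elim
      case (elim x)
      then show ?case
        using \<open>0 < \<eta>\<close> by (simp add: w_def frac_le)
    qed
  qed (use \<open>0 < \<eta>\<close> in simp)
  \<comment> \<open>Since \<open>A\<close> is nonnegative, the lower bound on \<open>B\<close> also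
    controls \<open>A + B\<close>.\<close>
  have v: "v \<in> O[F](\<lambda>x. h x ^ 0)"
  proof (rule landau_o.bigI[of "1 / sqrt \<eta>"])
    show "\<forall>\<^sub>F x in F. norm (v x) \<le> 1 / sqrt \<eta> * norm (h x ^ 0)"
      using evB
    proof eventually_elim
      case (elim x)
      moreover have "0 < sqrt \<eta>"
        using \<open>0 < \<eta>\<close> by simp
      ultimately show ?case
        using A_nonneg[of x] by (simp add: v_def frac_le)
    qed
  qed (use \<open>0 < \<eta>\<close> in simp)
  have pp: "(\<lambda>x. p1 x + p0 x) \<in> O[F](\<lambda>x. h x ^ 0)"
    using sum_in_bigo(1)[OF sum_in_bigo(1)[OF weaken[OF d[unfolded One_nat_def]] p0'] p0']
    by (simp add: d_def)
  \<comment> \<open>The next three terms are the costs of replacing, in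
    \<open>d^2 (p1 + p0) v^2\<close>, first \<open>d\<close> by \<open>h * q\<close>, then
    \<open>p1 + p0\<close> by \<open>2 * p0\<close>, and finally \<open>v\<close> by
    \<open>w / 2\<close>.\<close>
  have "(\<lambda>x. (d x - h x * q x) * (d x + h x * q x) * (p1 x + p0 x) * (v x * v x)) \<in> O[F](\<lambda>x. h x ^ 3)"
    by (rule mult[OF mult[OF mult[OF dq[folded d_def] sum_in_bigo(1)[OF d hq]] pp] mult[OF v v]]) auto
  moreover have "(\<lambda>x. (h x * q x) * (h x * q x) * d x * (v x * v x)) \<in> O[F](\<lambda>x. h x ^ 3)"
    by (rule mult[OF mult[OF mult[OF hq hq] d] mult[OF v v]]) auto
  moreover have "(\<lambda>x. (h x * q x) * (h x * q x) * p0 x * ((B x - A x) * (v x * w x) * (v x + w x / 2))) \<in> O[F](\<lambda>x. h x ^ 3)"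
    using w by (intro mult[OF mult[OF mult[OF hq hq] p0'] mult[OF mult[OF AB mult[OF v w]] sum_in_bigo(1)[OF v]]]) auto
  ultimately have sum: "(\<lambda>x. ((d x - h x * q x) * (d x + h x * q x) * (p1 x + p0 x) * (v x * v x)
      + (h x * q x) * (h x * q x) * d x * (v x * v x)
      + (h x * q x) * (h x * q x) * p0 x * ((B x - A x) * (v x * w x) * (v x + w x / 2))) / 2)
      \<in> O[F](\<lambda>x. h x ^ 3)"
    by (simp add: sum_in_bigo)
  have "eventually (\<lambda>x. chord_defect (s x) (p1 x) (p0 x)
      - h x ^ 2 * (p0 x * (q x)\<^sup>2 / (4 * ((s x)\<^sup>2 + (p0 x)\<^sup>2)))
    = ((d x - h x * q x) * (d x + h x * q x) * (p1 x + p0 x) * (v x * v x)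
      + (h x * q x) * (h x * q x) * d x * (v x * v x)
      + (h x * q x) * (h x * q x) * p0 x * ((B x - A x) * (v x * w x) * (v x + w x / 2))) / 2) F"
    using evB
  proof eventually_elim
    case (elim x)
    have B: "B x > 0"
      by (rule less_le_trans[OF _ elim]) (simp add: \<open>0 < \<eta>\<close>)
    have e1: "chord_defect (s x) (p1 x) (p0 x) = (d x)\<^sup>2 * (p1 x + p0 x) * (v x)\<^sup>2 / 2"
      by (simp add: chord_defect_def A_def B_def d_def v_def power_divide)
    have e2: "p0 x * (q x)\<^sup>2 / (4 * ((s x)\<^sup>2 + (p0 x)\<^sup>2)) = p0 x * (q x)\<^sup>2 * (w x)\<^sup>2 / 4"
      by (simp add: w_def B_def power_divide)
    \<comment> \<open>\<open>v - w / 2\<close> is \<open>(B - A) v w / 2\<close>, so the Lipschitz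
      bound makes it first order uniformly in the scale.\<close>
    have e3: "(B x - A x) * (v x * w x) * (v x + w x / 2) = 2 * (v x - w x / 2) * (v x + w x / 2)"
    proof -
      have "(B x - A x) * (v x * w x) = 2 * (v x - w x / 2)"
        using B A_nonneg[of x] by (simp add: v_def w_def divide_simps)
      then show ?thesis by simp
    qed
    show ?case
      unfolding e1 e2 e3 by (simp add: d_def field_simps power2_eq_square)
  qed
  then show ?thesis
    using sum by (subst landau_o.big.in_cong) 
qed

text \<open>Symmetry in the two ends gains one order over the expansion at the left end. Premise
  \<open>dm\<close> compares \<open>p1 - p0\<close> with \<open>h\<close> times the mean of
  \<open>q0\<close> and \<open>q1\<close>, which is the trapezoidal rule for the first derivative
  and has error of order \<open>h^3\<close>.\<close>

lemma chord_defect_symmetric_expansion: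
  fixes h s p0 p1 q0 q1 :: "'a \<Rightarrow> real"
  assumes "0 < \<eta>" and ev: "eventually (\<lambda>x. \<eta> \<le> (s x)\<^sup>2 + (p0 x)\<^sup>2) F"
    and ev': "eventually (\<lambda>x. \<eta> \<le> (s x)\<^sup>2 + (p1 x)\<^sup>2) F"
    and p0: "p0 \<in> O[F](\<lambda>_. 1)" and p1: "p1 \<in> O[F](\<lambda>_. 1)"
    and q0: "q0 \<in> O[F](\<lambda>_. 1)" and q1: "q1 \<in> O[F](\<lambda>_. 1)"
    and h: "h \<in> O[F](\<lambda>_. 1)"
    and dq: "(\<lambda>x. q1 x - q0 x) \<in> O[F](h)"
    and dm: "(\<lambda>x. p1 x - p0 x - h x * ((q0 x + q1 x) / 2)) \<in> O[F](\<lambda>x. h x ^ 3)"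
  shows "(\<lambda>x. chord_defect (s x) (p1 x) (p0 x)
      - h x ^ 2 / 8 * (p0 x * (q0 x)\<^sup>2 / ((s x)\<^sup>2 + (p0 x)\<^sup>2) + p1 x * (q1 x)\<^sup>2 / ((s x)\<^sup>2 + (p1 x)\<^sup>2)))
      \<in> O[F](\<lambda>x. h x ^ 4)"
proof -
  define A where "A x = sqrt ((s x)\<^sup>2 + (p1 x)\<^sup>2)" for x
  define B where "B x = sqrt ((s x)\<^sup>2 + (p0 x)\<^sup>2)" for x
  define d where "d x = p1 x - p0 x" for x
  define e where "e x = q1 x - q0 x" for x
  define m where "m x = (q0 x + q1 x) / 2" for x
  define v where "v x = 1 / (A x + B x)" for x
  define z0 where "z0 x = 1 / ((s x)\<^sup>2 + (p0 x)\<^sup>2)" for x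
  define z1 where "z1 x = 1 / ((s x)\<^sup>2 + (p1 x)\<^sup>2)" for x
  define z where "z x = 1 / ((s x)\<^sup>2 + (p0 x)\<^sup>2 + ((s x)\<^sup>2 + (p1 x)\<^sup>2))" for x
  note mult = bigo_power_mult[where h = h]
  have p0': "p0 \<in> O[F](\<lambda>x. h x ^ 0)" and p1': "p1 \<in> O[F](\<lambda>x. h x ^ 0)"
    and q0': "q0 \<in> O[F](\<lambda>x. h x ^ 0)" and q1': "q1 \<in> O[F](\<lambda>x. h x ^ 0)"
    and h': "h \<in> O[F](\<lambda>x. h x ^ 1)" and h2: "(\<lambda>x. h x ^ 2) \<in> O[F](\<lambda>x. h x ^ 2)"
    using p0 p1 q0 q1 by simp_all
  have e: "e \<in> O[F](\<lambda>x. h x ^ 1)"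
    unfolding e_def[abs_def] using dq by simp
  have m: "m \<in> O[F](\<lambda>x. h x ^ 0)"
    unfolding m_def[abs_def] using sum_in_bigo(1)[OF q0' q1'] by simp
  have hm: "(\<lambda>x. h x * m x) \<in> O[F](\<lambda>x. h x ^ 1)"
    by (rule mult[OF h' m]) simp
  note weaken = bigo_power_Suc_weaken[OF _ h]
  have dm': "(\<lambda>x. d x - h x * m x) \<in> O[F](\<lambda>x. h x ^ 1)"
    using weaken[OF weaken[OF dm[unfolded numeral_3_eq_3]]] by (simp add: d_def m_def)
  have d: "d \<in> O[F](\<lambda>x. h x ^ 1)"
    using sum_in_bigo(1)[OF dm' hm] by simp
  have AB: "(\<lambda>x. B x - A x) \<in> O[F](\<lambda>x. h x ^ 1)"
  proof (rule landau_o.big_trans[OF _ d], rule landau_o.bigI[of 1])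
    show "\<forall>\<^sub>F x in F. norm (B x - A x) \<le> 1 * norm (d x)"
      using sqrt_sum_squares_lipschitz by (simp add: A_def B_def d_def abs_minus_commute)
  qed simp
  have bounded: "f \<in> O[F](\<lambda>x. h x ^ 0)"
    if "eventually (\<lambda>x. \<bar>f x\<bar> \<le> c) F" and "c > 0" for f :: "'a \<Rightarrow> real" and c
    by (rule landau_o.bigI[of c]) (use that in simp_all)
  have z0: "z0 \<in> O[F](\<lambda>x. h x ^ 0)"
    by (rule bounded[of _ "1 / \<eta>"])
      (use ev \<open>0 < \<eta>\<close> in \<open>auto simp: z0_def frac_le elim!: eventually_mono\<close>)
  have z1: "z1 \<in> O[F](\<lambda>x. h x ^ 0)"
    by (rule bounded[of _ "1 / \<eta>"])
      (use ev' \<open>0 < \<eta>\<close> in \<open>auto simp: z1_def frac_le elim!: eventually_mono\<close>)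
  have z: "z \<in> O[F](\<lambda>x. h x ^ 0)"
  proof (rule bounded[of _ "1 / \<eta>"])
    show "\<forall>\<^sub>F x in F. \<bar>z x\<bar> \<le> 1 / \<eta>"
      using ev
    proof eventually_elim
      case (elim x)
      have "\<eta> \<le> (s x)\<^sup>2 + (p0 x)\<^sup>2 + ((s x)\<^sup>2 + (p1 x)\<^sup>2)"
        using elim zero_le_power2[of "s x"] zero_le_power2[of "p1 x"] by linarith
      then show ?case
        using \<open>0 < \<eta>\<close> by (simp add: z_def frac_le)
    qed
  qed (use \<open>0 < \<eta>\<close> in simp)
  have A_nonneg: "A x \<ge> 0" for x
    by (simp add: A_def)
  have v: "v \<in> O[F](\<lambda>x. h x ^ 0)"
  proof (rule bounded[of _ "1 / sqrt \<eta>"])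
    show "\<forall>\<^sub>F x in F. \<bar>v x\<bar> \<le> 1 / sqrt \<eta>"
      using ev
    proof eventually_elim
      case (elim x)
      then have "sqrt \<eta> \<le> B x" "0 < sqrt \<eta>"
        using \<open>0 < \<eta>\<close> by (simp_all add: B_def)
      then show ?case
        using A_nonneg[of x] by (simp add: v_def frac_le)
    qed
  qed (use \<open>0 < \<eta>\<close> in simp)
  have pp: "(\<lambda>x. p0 x + p1 x) \<in> O[F](\<lambda>x. h x ^ 0)"
    by (rule sum_in_bigo(1)[OF p0' p1'])
  have qq: "(\<lambda>x. q0 x + q1 x) \<in> O[F](\<lambda>x. h x ^ 0)"
    by (rule sum_in_bigo(1)[OF q0' q1'])
  have zz: "(\<lambda>x. z0 x + z1 x) \<in> O[F](\<lambda>x. h x ^ 0)"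
    by (rule sum_in_bigo(1)[OF z0 z1])
  txt \<open>Up to \<open>O(h\<^sup>4)\<close>, the defect is \<open>h\<^sup>2 / 4\<close> times the product of the means over the two endpoints of
    \<open>q\<^sup>2\<close>, \<open>p\<close> and \<open>1 / (s\<^sup>2 + p\<^sup>2)\<close>. This differs from the mean of the products only by terms that contain
    two increments, each of which is \<open>O(h)\<close>.\<close>
  define X where "X x = (q0 x)\<^sup>2 + (q1 x)\<^sup>2" for x
  define D where "D x = (d x)\<^sup>2 - h x ^ 2 * X x / 2" for x
  define V where "V x = (v x)\<^sup>2 - (z0 x + z1 x) / 8" for x
  define x' where "x' x = (q1 x)\<^sup>2 - (q0 x)\<^sup>2" for x
  define z' where "z' x = z1 x - z0 x" for x
  have X: "X \<in> O[F](\<lambda>x. h x ^ 0)"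
    unfolding X_def[abs_def] power2_eq_square by (intro sum_in_bigo mult[OF q0' q0'] mult[OF q1' q1']) auto
  \<comment> \<open>With \<open>m\<close> the mean of \<open>q0\<close> and \<open>q1\<close> and
    \<open>e\<close> their difference, \<open>X / 2 = m^2 + e^2 / 4\<close>. Thus \<open>D\<close>
    splits into \<open>d^2 - (h m)^2\<close>, of order 3 + 1, and \<open>h^2 e^2 / 4\<close>, of
    order 2 + 2.\<close>
  have D: "D \<in> O[F](\<lambda>x. h x ^ 4)"
  proof -
    have "(\<lambda>x. (d x - h x * m x) * (d x + h x * m x)) \<in> O[F](\<lambda>x. h x ^ 4)"
      using dm by (intro mult[OF _ sum_in_bigo(1)[OF d hm]]) (auto simp: d_def m_def)
    moreover have "(\<lambda>x. h x ^ 2 * (e x * e x) / 4) \<in> O[F](\<lambda>x. h x ^ 4)"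
      using mult[OF h2 mult[OF e e refl]] by simp
    ultimately have "(\<lambda>x. (d x - h x * m x) * (d x + h x * m x) - h x ^ 2 * (e x * e x) / 4) \<in> O[F](\<lambda>x. h x ^ 4)"
      by (rule sum_in_bigo(2))
    moreover have "(\<lambda>x. (d x - h x * m x) * (d x + h x * m x) - h x ^ 2 * (e x * e x) / 4) = D"
      by (simp add: fun_eq_iff D_def X_def e_def m_def field_simps power2_eq_square)
    ultimately show ?thesis by simp
  qed
  have x': "x' \<in> O[F](\<lambda>x. h x ^ 1)"
    unfolding x'_def[abs_def] using mult[OF e qq refl]
    by (simp add: e_def power2_eq_square algebra_simps)
  have nz: "eventually (\<lambda>x. (s x)\<^sup>2 + (p0 x)\<^sup>2 > 0 \<and> (s x)\<^sup>2 + (p1 x)\<^sup>2 > 0) F"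
    using ev ev' by eventually_elim (use \<open>0 < \<eta>\<close> in auto)
  have dpp: "(\<lambda>x. d x * (p0 x + p1 x)) \<in> O[F](\<lambda>x. h x ^ 1)"
    by (rule mult[OF d pp]) simp
  \<comment> \<open>The difference of the two denominators is
    \<open>p1^2 - p0^2 = d (p0 + p1)\<close>, in which the scale has cancelled.\<close>
  have z': "z' \<in> O[F](\<lambda>x. h x ^ 1)"
  proof -
    have "(\<lambda>x. - (d x * (p0 x + p1 x) * (z0 x * z1 x))) \<in> O[F](\<lambda>x. h x ^ 1)"
      using mult[OF dpp mult[OF z0 z1 refl] refl] by simp
    moreover have "eventually (\<lambda>x. z' x = - (d x * (p0 x + p1 x) * (z0 x * z1 x))) F"
      using nz
    proof eventually_elim
      case (elim x)
      have "d x * (p0 x + p1 x) = ((s x)\<^sup>2 + (p1 x)\<^sup>2) - ((s x)\<^sup>2 + (p0 x)\<^sup>2)"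
        by (simp add: d_def algebra_simps power2_eq_square)
      moreover have "1 / Q - 1 / P = - ((Q - P) * (1 / P * (1 / Q)))" if "P > 0" "Q > 0" for P Q :: real
        using that by (simp add: field_simps)
      ultimately show ?case
        using elim by (simp only: z'_def z0_def z1_def)
    qed
    ultimately show ?thesis by (subst landau_o.big.in_cong)
  qed
  \<comment> \<open>With \<open>P\<close> and \<open>Q\<close> the squares of \<open>B\<close> and
    \<open>A\<close>, the value \<open>z / 2 = 1 / (2 (P + Q))\<close> is put between
    \<open>v^2\<close> and \<open>(z0 + z1) / 8\<close>. The two gaps carry the squares
    \<open>(B - A)^2\<close> and \<open>(Q - P)^2\<close>, so each is second order.\<close>
  have V: "V \<in> O[F](\<lambda>x. h x ^ 2)"
  proof -
    have "(\<lambda>x. v x * v x * z x * ((B x - A x) * (B x - A x)) / 2) \<in> O[F](\<lambda>x. h x ^ 2)"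
      using mult[OF mult[OF mult[OF v v refl] z refl] mult[OF AB AB refl], where k = 2] by simp
    moreover have "(\<lambda>x. z x * z0 x * z1 x * ((d x * (p0 x + p1 x)) * (d x * (p0 x + p1 x))) / 8) \<in> O[F](\<lambda>x. h x ^ 2)"
      using mult[OF mult[OF mult[OF z z0 refl] z1 refl] mult[OF dpp dpp refl], where k = 2] by simp
    ultimately have "(\<lambda>x. v x * v x * z x * ((B x - A x) * (B x - A x)) / 2
        - z x * z0 x * z1 x * ((d x * (p0 x + p1 x)) * (d x * (p0 x + p1 x))) / 8) \<in> O[F](\<lambda>x. h x ^ 2)"
      by (rule sum_in_bigo(2))
    moreover have "eventually (\<lambda>x. V x = v x * v x * z x * ((B x - A x) * (B x - A x)) / 2
        - z x * z0 x * z1 x * ((d x * (p0 x + p1 x)) * (d x * (p0 x + p1 x))) / 8) F"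
      using nz
    proof eventually_elim
      case (elim x)
      define P where "P = (s x)\<^sup>2 + (p0 x)\<^sup>2"
      define Q where "Q = (s x)\<^sup>2 + (p1 x)\<^sup>2"
      have PQ: "P > 0" "Q > 0"
        using elim by (simp_all add: P_def Q_def)
      have AB: "A x > 0" "B x > 0" "(A x)\<^sup>2 = Q" "(B x)\<^sup>2 = P"
        using elim by (simp_all add: A_def B_def P_def Q_def)
      have dPQ: "d x * (p0 x + p1 x) = Q - P"
        by (simp add: P_def Q_def d_def algebra_simps power2_eq_square)
      have zs: "z x = 1 / (P + Q)" "z0 x = 1 / P" "z1 x = 1 / Q"
        by (simp_all add: z_def z0_def z1_def P_def Q_def)
      have "v x * v x * z x * ((B x - A x) * (B x - A x)) / 2 = (v x)\<^sup>2 - z x / 2"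
      proof -
        have "(B x - A x) * (B x - A x) = 2 * (P + Q) - (A x + B x)\<^sup>2"
          unfolding AB(3,4)[symmetric] by (simp add: algebra_simps power2_eq_square)
        moreover have "v x * v x * (A x + B x)\<^sup>2 = 1"
          using AB by (simp add: v_def power2_eq_square)
        moreover have "z x * (P + Q) = 1"
          using PQ by (simp add: zs)
        ultimately show ?thesis
          by (simp add: field_simps power2_eq_square) algebra
      qed
      moreover have "z x * z0 x * z1 x * ((Q - P) * (Q - P)) / 8 = (z0 x + z1 x) / 8 - z x / 2"
        unfolding zs using PQ by (simp add: divide_simps) (simp add: algebra_simps)
      ultimately show ?case
        unfolding dPQ V_def by (simp add: field_simps)
    qed
    ultimately show ?thesis by (subst landau_o.big.in_cong)
  qed
  have "(\<lambda>x. D x * (p0 x + p1 x) * (v x * v x) / 2) \<in> O[F](\<lambda>x. h x ^ 4)"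
    using mult[OF mult[OF D pp refl] mult[OF v v refl], where k = 4] by simp
  moreover have "(\<lambda>x. h x ^ 2 * X x * (p0 x + p1 x) * V x / 4) \<in> O[F](\<lambda>x. h x ^ 4)"
    using mult[OF mult[OF mult[OF h2 X refl] pp refl] V, where k = 4] by simp
  \<comment> \<open>For two triples, four times the sum of the two products is the product of the
    three sums plus the three terms that take one sum and two differences. With the prefactor 1/8 of
    the claim this gives 1/32.\<close>
  moreover have "(\<lambda>x. h x ^ 2 * (X x * (d x * z' x) + (p0 x + p1 x) * (x' x * z' x)
      + (z0 x + z1 x) * (x' x * d x)) / 32) \<in> O[F](\<lambda>x. h x ^ 4)"
  proof -
    have "(\<lambda>x. X x * (d x * z' x) + (p0 x + p1 x) * (x' x * z' x)
      + (z0 x + z1 x) * (x' x * d x)) \<in> O[F](\<lambda>x. h x ^ 2)"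
      by (intro sum_in_bigo(1) mult[OF X mult[OF d z' refl]] mult[OF pp mult[OF x' z' refl]]
          mult[OF zz mult[OF x' d refl]]) simp_all
    from mult[OF h2 this, where k = 4] show ?thesis by simp
  qed
  ultimately have "(\<lambda>x. D x * (p0 x + p1 x) * (v x * v x) / 2 + h x ^ 2 * X x * (p0 x + p1 x) * V x / 4
      - h x ^ 2 * (X x * (d x * z' x) + (p0 x + p1 x) * (x' x * z' x)
      + (z0 x + z1 x) * (x' x * d x)) / 32) \<in> O[F](\<lambda>x. h x ^ 4)"
    by (intro sum_in_bigo)
  moreover have "(\<lambda>x. chord_defect (s x) (p1 x) (p0 x)
      - h x ^ 2 / 8 * (p0 x * (q0 x)\<^sup>2 / ((s x)\<^sup>2 + (p0 x)\<^sup>2) + p1 x * (q1 x)\<^sup>2 / ((s x)\<^sup>2 + (p1 x)\<^sup>2)))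
    = (\<lambda>x. D x * (p0 x + p1 x) * (v x * v x) / 2 + h x ^ 2 * X x * (p0 x + p1 x) * V x / 4
      - h x ^ 2 * (X x * (d x * z' x) + (p0 x + p1 x) * (x' x * z' x)
      + (z0 x + z1 x) * (x' x * d x)) / 32)"
  proof
    fix x
    have e1: "chord_defect (s x) (p1 x) (p0 x) = (d x)\<^sup>2 * (p0 x + p1 x) * (v x)\<^sup>2 / 2"
      by (simp add: chord_defect_def A_def B_def d_def v_def power_divide add.commute)
    have e2: "p0 x * (q0 x)\<^sup>2 / ((s x)\<^sup>2 + (p0 x)\<^sup>2) = p0 x * (q0 x)\<^sup>2 * z0 x"
      "p1 x * (q1 x)\<^sup>2 / ((s x)\<^sup>2 + (p1 x)\<^sup>2) = p1 x * (q1 x)\<^sup>2 * z1 x"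
      by (simp_all add: z0_def z1_def)
    show "chord_defect (s x) (p1 x) (p0 x)
        - h x ^ 2 / 8 * (p0 x * (q0 x)\<^sup>2 / ((s x)\<^sup>2 + (p0 x)\<^sup>2) + p1 x * (q1 x)\<^sup>2 / ((s x)\<^sup>2 + (p1 x)\<^sup>2))
      = D x * (p0 x + p1 x) * (v x * v x) / 2 + h x ^ 2 * X x * (p0 x + p1 x) * V x / 4
        - h x ^ 2 * (X x * (d x * z' x) + (p0 x + p1 x) * (x' x * z' x)
        + (z0 x + z1 x) * (x' x * d x)) / 32"
      unfolding e1 e2 D_def V_def X_def x'_def z'_def d_def by (simp add: field_simps power2_eq_square)
  qed
  ultimately show ?thesis
    by simp
qed

section \<open>Curvature of a scaled graph\<close>

text \<open>A Euclidean codomain is allowed because the rule is applied both to real functions and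
  to the planar curve \<open>scaled_curve\<close>.\<close>

lemma deriv_within_eq:
  fixes f :: "real \<Rightarrow> 'a::euclidean_space"
  assumes "a < b" and "t \<in> {a..b}" and "(f has_vector_derivative f') (at t within {a..b})"
  shows "deriv_within {a..b} f t = f'"
  unfolding deriv_within_def using assms by (rule vector_derivative_within_closed_interval)

lemma C_k_on_has_real_derivative:
  assumes "C_k_on k S f" and "i < k" and "t \<in> S"
  shows "((deriv_within S ^^ i) f has_real_derivative (deriv_within S ^^ Suc i) f t) (at t within S)"
proof -
  have "(deriv_within S ^^ i) f differentiable (at t within S)"
    using assms by (auto simp: C_k_on_def)
  then show ?thesis
    by (simp add: deriv_within_def vector_derivative_works has_real_derivative_iff_has_vector_derivative)
qed

lemma C_k_on_continuous_on:
  assumes "C_k_on k S f" and "i \<le> k"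
  shows "continuous_on S ((deriv_within S ^^ i) f)"
proof (cases "i = k")
  case False
  then show ?thesis
    using assms C_k_on_has_real_derivative[OF assms(1), of i]
    by (intro DERIV_continuous_on) auto
qed (use assms in \<open>simp add: C_k_on_def\<close>)

lemma C_k_on_mono:
  assumes "C_k_on k S f" and "j \<le> k"
  shows "C_k_on j S f"
  using assms C_k_on_continuous_on[OF assms] by (auto simp: C_k_on_def)

text \<open>With \<open>S = sqrt (s^2 + p^2)\<close> the speed is \<open>S / s\<close> and the
  curvature is \<open>s^2 q / S^3\<close>. Since \<open>S' = p q / S\<close>, the derivative of the
  curvature is \<open>s^2 (r / S^3 - 3 p q^2 / S^5)\<close>, and the prefactor
  \<open>s (S / s)^3 = S^3 / s^2\<close> removes the outer powers of \<open>s\<close> and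
  \<open>S\<close>.\<close>

lemma speed_cubed_curvature_deriv:
  assumes "t0 < T" and u: "C_k_on 3 {t0..T} u" and t: "t \<in> {t0..T}" and s: "s > 0"
  shows "s * curve_speed t0 T u s t ^ 3 * curvature_deriv t0 T u s t =
    (deriv_within {t0..T} ^^ 3) u t -
    3 * (deriv_within {t0..T} u t * ((deriv_within {t0..T} ^^ 2) u t)\<^sup>2 /
      (s\<^sup>2 + (deriv_within {t0..T} u t)\<^sup>2))"
proof -
  define p where "p = deriv_within {t0..T} u"
  define q where "q = (deriv_within {t0..T} ^^ 2) u"
  define r where "r = (deriv_within {t0..T} ^^ 3) u"
  define S where "S y = sqrt (s\<^sup>2 + (p y)\<^sup>2)" for y
  have u': "(u has_real_derivative p t) (at t within {t0..T})"
    using C_k_on_has_real_derivative[OF u _ t, of 0] by (simp add: p_def)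
  have p': "(p has_real_derivative q t) (at t within {t0..T})"
    using C_k_on_has_real_derivative[OF u _ t, of 1] by (simp add: p_def q_def numeral_2_eq_2)
  have q': "(q has_real_derivative r t) (at t within {t0..T})"
    using C_k_on_has_real_derivative[OF u _ t, of 2] by (simp add: q_def r_def numeral_eq_Suc)
  have pos: "s\<^sup>2 + (p y)\<^sup>2 > 0" for y
    using s by (simp add: add_pos_nonneg)
  have S: "S y > 0" "(S y)\<^sup>2 = s\<^sup>2 + (p y)\<^sup>2" for y
    using pos[of y] by (simp_all add: S_def)
  have "(scaled_curve u s has_vector_derivative (1, p t / s)) (at t within {t0..T})"
  proof -
    have "((\<lambda>y. u y / s) has_vector_derivative p t / s) (at t within {t0..T})"
      using DERIV_cdivide[OF u', of s] by (simp add: has_real_derivative_iff_has_vector_derivative)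
    then show ?thesis
      unfolding scaled_curve_def[abs_def]
      by (intro has_vector_derivative_Pair) auto
  qed
  from deriv_within_eq[OF assms(1) t this] have "curve_speed t0 T u s t = sqrt (1 + (p t / s)\<^sup>2)"
    by (simp add: curve_speed_def norm_Pair power_divide)
  also have "1 + (p t / s)\<^sup>2 = (S t / s)\<^sup>2"
    using s by (simp add: S power_divide) (simp add: field_simps)
  also have "sqrt \<dots> = S t / s"
    using s S(1)[of t] by simp
  finally have speed: "curve_speed t0 T u s t = S t / s" .
  have "(s\<^sup>2 + (p y)\<^sup>2) powr (3 / 2) = S y ^ 3" for y
  proof -
    have "S y ^ 3 = S y powr 3"
      using S(1)[of y] by (simp add: powr_numeral)
    also have "\<dots> = (s\<^sup>2 + (p y)\<^sup>2) powr (3 / 2)"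
      using pos[of y] by (simp add: S_def powr_half_sqrt[symmetric] powr_powr)
    finally show ?thesis by simp
  qed
  then have curvature: "curvature t0 T u s = (\<lambda>y. s\<^sup>2 * q y / S y ^ 3)"
    by (simp add: curvature_def fun_eq_iff p_def q_def)
  have Q': "((\<lambda>y. s\<^sup>2 + (p y)\<^sup>2) has_real_derivative 2 * (p t * q t)) (at t within {t0..T})"
    using DERIV_add[OF DERIV_const[of "s\<^sup>2"] DERIV_power[OF p', of 2]] by (simp add: ac_simps)
  have "((\<lambda>y. sqrt (s\<^sup>2 + (p y)\<^sup>2)) has_real_derivative
      inverse (sqrt (s\<^sup>2 + (p t)\<^sup>2)) / 2 * (2 * (p t * q t))) (at t within {t0..T})"
    by (rule DERIV_chain2[of sqrt _ "\<lambda>y. s\<^sup>2 + (p y)\<^sup>2", OF DERIV_real_sqrt[OF pos[of t]] Q'])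
  then have "(S has_real_derivative inverse (S t) / 2 * (2 * (p t * q t))) (at t within {t0..T})"
    by (simp only: S_def[abs_def])
  then have S': "(S has_real_derivative p t * q t / S t) (at t within {t0..T})"
    by (rule DERIV_cong) (simp add: field_simps)
  define E where "E = 3 * (p t * q t / S t) * (S t)\<^sup>2"
  have S3': "((\<lambda>y. S y ^ 3) has_real_derivative E) (at t within {t0..T})"
    using DERIV_power[OF S', of 3] by (simp add: E_def ac_simps)
  have "(curvature t0 T u s has_real_derivative
      (s\<^sup>2 * r t * S t ^ 3 - s\<^sup>2 * q t * E) / (S t ^ 3 * S t ^ 3)) (at t within {t0..T})"
    unfolding curvature using S(1)[of t]
    by (intro DERIV_divide DERIV_cmult q' S3') auto
  then have curvature_deriv: "curvature_deriv t0 T u s t = (s\<^sup>2 * r t * S t ^ 3 - s\<^sup>2 * q t * E) / (S t ^ 3 * S t ^ 3)"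
    unfolding curvature_deriv_def
    by (intro deriv_within_eq[OF assms(1) t]) (simp add: has_real_derivative_iff_has_vector_derivative)
  have "s * curve_speed t0 T u s t ^ 3 * curvature_deriv t0 T u s t = r t - 3 * (p t * (q t)\<^sup>2 / (S t)\<^sup>2)"
    unfolding speed curvature_deriv E_def using s S(1)[of t]
    by (simp add: field_simps eval_nat_numeral)
  then show ?thesis
    by (simp add: S p_def q_def r_def)
qed

section \<open>Taylor expansion and uniform asymptotics\<close>

text \<open>The highest derivative is bounded on the whole compact interval, so one constant serves
  all pairs \<open>a x\<close>, \<open>b x\<close>, however they move along the filter.\<close>

lemma taylor_bigo:
  fixes f :: "nat \<Rightarrow> real \<Rightarrow> real" and a b :: "'a \<Rightarrow> real"
  assumes f: "\<And>i y. i \<le> m \<Longrightarrow> y \<in> {l..r} \<Longrightarrow> (f i has_real_derivative f (Suc i) y) (at y within {l..r})"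
    and cont: "continuous_on {l..r} (f (Suc m))"
    and a: "eventually (\<lambda>x. a x \<in> {l..r}) F" and b: "eventually (\<lambda>x. b x \<in> {l..r}) F"
  shows "(\<lambda>x. f 0 (b x) - (\<Sum>i\<le>m. f i (a x) * (b x - a x) ^ i / fact i)) \<in> O[F](\<lambda>x. (b x - a x) ^ Suc m)"
proof -
  have "bounded (f (Suc m) ` {l..r})"
    by (intro compact_imp_bounded compact_continuous_image cont) simp
  then obtain B where B: "norm (f (Suc m) y) \<le> B" if "y \<in> {l..r}" for y
    unfolding bounded_iff by blast
  show ?thesis
  proof (rule bigoI)
    show "\<forall>\<^sub>F x in F. norm (f 0 (b x) - (\<Sum>i\<le>m. f i (a x) * (b x - a x) ^ i / fact i))
        \<le> B / fact m * norm ((b x - a x) ^ Suc m)"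
      using a b
    proof eventually_elim
      case (elim x)
      have "convex {l..r}" by simp
      from field_Taylor[OF this f B elim] show ?case
        by (simp add: abs_mult power_abs)
    qed
  qed
qed

text \<open>Uniform continuity of the highest derivative replaces a bound on the next one: after
  subtraction of the top Taylor term at \<open>a x\<close>, the highest derivative is its own
  increment from \<open>a x\<close>, which is small on a short segment.\<close>

lemma taylor_smallo:
  fixes f :: "nat \<Rightarrow> real \<Rightarrow> real" and a b :: "'a \<Rightarrow> real"
  assumes f: "\<And>i y. i \<le> m \<Longrightarrow> y \<in> {l..r} \<Longrightarrow> (f i has_real_derivative f (Suc i) y) (at y within {l..r})"
    and cont: "continuous_on {l..r} (f (Suc m))"
    and a: "eventually (\<lambda>x. a x \<in> {l..r}) F" and b: "eventually (\<lambda>x. b x \<in> {l..r}) F"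
    and lim: "((\<lambda>x. b x - a x) \<longlongrightarrow> 0) F"
  shows "(\<lambda>x. f 0 (b x) - (\<Sum>i\<le>Suc m. f i (a x) * (b x - a x) ^ i / fact i)) \<in> o[F](\<lambda>x. (b x - a x) ^ Suc m)"
proof (rule landau_o.smallI)
  fix c :: real
  assume c: "c > 0"
  have "uniformly_continuous_on {l..r} (f (Suc m))"
    by (intro compact_uniformly_continuous cont) simp
  then obtain d where d: "d > 0"
    "\<And>y z. y \<in> {l..r} \<Longrightarrow> z \<in> {l..r} \<Longrightarrow> dist z y < d \<Longrightarrow> dist (f (Suc m) z) (f (Suc m) y) < c"
    using c unfolding uniformly_continuous_on_def by metis
  have "eventually (\<lambda>x. \<bar>b x - a x\<bar> < d) F"
    using tendstoD[OF lim d(1)] by simp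
  then show "\<forall>\<^sub>F x in F. norm (f 0 (b x) - (\<Sum>i\<le>Suc m. f i (a x) * (b x - a x) ^ i / fact i))
      \<le> c * norm ((b x - a x) ^ Suc m)"
    using a b
  proof eventually_elim
    case (elim x)
    define S where "S = closed_segment (a x) (b x)"
    \<comment> \<open>\<open>g i\<close> is the \<open>i\<close>-th derivative of \<open>f 0\<close>
      minus its Taylor monomial of degree \<open>Suc m\<close> at \<open>a x\<close>. At
      \<open>i = Suc m\<close> the power is constant and the increment remains.\<close>
    define g where "g i y = f i y - f (Suc m) (a x) * (y - a x) ^ (Suc m - i) / fact (Suc m - i)" for i y
    have S: "S \<subseteq> {l..r}"
      unfolding S_def using elim by (intro closed_segment_subset) auto
    have near: "\<bar>y - a x\<bar> < d" if "y \<in> S" for y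
      using that elim(1) by (auto simp: S_def closed_segment_eq_real_ivl split: if_splits)
    have "(g i has_real_derivative g (Suc i) y) (at y within S)" if "y \<in> S" "i \<le> m" for y i
    proof -
      have "(f i has_real_derivative f (Suc i) y) (at y within S)"
        using f[OF that(2) subsetD[OF S that(1)]] S by (rule DERIV_subset)
      moreover have "((\<lambda>y. f (Suc m) (a x) * (y - a x) ^ Suc (m - i) / fact (Suc (m - i)))
          has_real_derivative f (Suc m) (a x) * (y - a x) ^ (m - i) / fact (m - i)) (at y within S)"
      proof -
        have "((\<lambda>y. (y - a x) ^ Suc (m - i)) has_real_derivative real (Suc (m - i)) * (y - a x) ^ (m - i))
            (at y within S)"
          using DERIV_power[OF DERIV_diff[OF DERIV_ident DERIV_const], where n = "Suc (m - i)"] by simp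
        from DERIV_cdivide[OF DERIV_cmult[OF this]] show ?thesis
          by (rule DERIV_cong) (simp add: fact_Suc del: of_nat_Suc)
      qed
      ultimately show ?thesis
        unfolding g_def[abs_def] using that(2) by (simp only: Suc_diff_le diff_Suc_Suc DERIV_diff)
    qed
    moreover have "norm (g (Suc m) y) \<le> c" if "y \<in> S" for y
    proof -
      have "dist (f (Suc m) y) (f (Suc m) (a x)) < c"
        using that S near[OF that] elim by (intro d(2)) (auto simp: dist_real_def)
      then show ?thesis
        by (simp add: g_def dist_real_def)
    qed
    ultimately have "norm (g 0 (b x) - (\<Sum>i\<le>m. g i (a x) * (b x - a x) ^ i / fact i))
        \<le> c * norm (b x - a x) ^ Suc m / fact m"
      by (intro field_Taylor[of S]) (auto simp: S_def)
    also have "\<dots> \<le> c * norm (b x - a x) ^ Suc m"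
    proof -
      have "c * norm (b x - a x) ^ Suc m / fact m \<le> c * norm (b x - a x) ^ Suc m / 1"
        using c by (intro divide_left_mono mult_nonneg_nonneg) auto
      then show ?thesis by simp
    qed
    \<comment> \<open>The subtracted monomial and its derivatives up to order \<open>m\<close>
      vanish at \<open>a x\<close>, so the lower Taylor coefficients are unchanged.\<close>
    also have "(\<Sum>i\<le>m. g i (a x) * (b x - a x) ^ i / fact i) = (\<Sum>i\<le>m. f i (a x) * (b x - a x) ^ i / fact i)"
      by (intro sum.cong) (auto simp: g_def)
    also have "g 0 (b x) - \<dots> = f 0 (b x) - (\<Sum>i\<le>Suc m. f i (a x) * (b x - a x) ^ i / fact i)"
      by (simp add: g_def)
    finally show ?case
      by (simp only: norm_power)
  qed
qed

lemma continuous_on_interval_bigo: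
  fixes f :: "real \<Rightarrow> real"
  assumes "continuous_on {l..r} f" and "eventually (\<lambda>x. a x \<in> {l..r}) F"
  shows "(\<lambda>x. f (a x)) \<in> O[F](\<lambda>_. 1)"
proof -
  have "bounded (f ` {l..r})"
    by (intro compact_imp_bounded compact_continuous_image assms) simp
  then obtain B where "norm (f y) \<le> B" if "y \<in> {l..r}" for y
    unfolding bounded_iff by blast
  then show ?thesis
    using assms(2) by (intro bigoI[of _ B]) (auto elim!: eventually_mono)
qed

text \<open>The theorem restricts the index by \<open>num_steps\<close> in its identities and by the
  next grid point in its bounds; this connects the two. If \<open>T < t0\<close>, both sides are
  false, as \<open>nat\<close> truncates the negative floor to 0.\<close>

lemma less_num_steps_iff:
  assumes "h > 0"
  shows "n < num_steps t0 T h \<longleftrightarrow> grid t0 h (n + 1) \<le> T"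
proof -
  have "n < num_steps t0 T h \<longleftrightarrow> int n + 1 \<le> \<lfloor>(T - t0) / h\<rfloor>"
    by (auto simp: num_steps_def zless_nat_eq_int_zless)
  also have "\<dots> \<longleftrightarrow> (real n + 1) * h \<le> T - t0"
    using assms by (simp add: le_floor_iff pos_le_divide_eq)
  finally show ?thesis
    by (auto simp: grid_def algebra_simps)
qed

text \<open>Landau symbols along this filter are uniform in the step index.\<close>

definition step_filter :: "real \<Rightarrow> real \<Rightarrow> real \<Rightarrow> (real \<times> nat) filter" where
  "step_filter t0 T H =
     inf (filtercomap fst (at_right 0)) (principal {(h, n). h \<in> {0<..H} \<and> n < num_steps t0 T h})"

lemma eventually_step_filter:
  assumes "H > 0"
  shows "eventually P (step_filter t0 T H) \<longleftrightarrow>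
    (\<exists>h0\<in>{0<..H}. \<forall>h\<in>{0<..h0}. \<forall>n<num_steps t0 T h. P (h, n))"
proof
  assume "eventually P (step_filter t0 T H)"
  then obtain Q where "eventually Q (at_right (0::real))"
    and Q: "\<And>h n. Q h \<Longrightarrow> h \<in> {0<..H} \<Longrightarrow> n < num_steps t0 T h \<Longrightarrow> P (h, n)"
    unfolding step_filter_def eventually_inf_principal eventually_filtercomap by auto
  then obtain d where "d > 0" "\<And>h. 0 < h \<Longrightarrow> h < d \<Longrightarrow> Q h"
    by (auto simp: eventually_at_right_field)
  then show "\<exists>h0\<in>{0<..H}. \<forall>h\<in>{0<..h0}. \<forall>n<num_steps t0 T h. P (h, n)"
    \<comment> \<open>\<open>d\<close> is halved because \<open>Q\<close> is known only for
      \<open>h < d\<close>, while \<open>h0\<close> itself must be admissible.\<close>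
    using assms by (intro bexI[of _ "min (d / 2) H"]) (auto intro!: Q)
next
  assume "\<exists>h0\<in>{0<..H}. \<forall>h\<in>{0<..h0}. \<forall>n<num_steps t0 T h. P (h, n)"
  then obtain h0 where "h0 > 0" "\<And>h n. 0 < h \<Longrightarrow> h \<le> h0 \<Longrightarrow> n < num_steps t0 T h \<Longrightarrow> P (h, n)"
    by auto
  moreover from this have "eventually (\<lambda>h. h \<le> h0) (at_right 0)"
    by (auto simp: eventually_at_right_field intro!: exI[of _ h0])
  ultimately show "eventually P (step_filter t0 T H)"
    unfolding step_filter_def eventually_inf_principal eventually_filtercomap
    by (intro exI[of _ "\<lambda>h. h \<le> h0"]) auto
qed

lemma step_filter_bigoD:
  assumes "H > 0" and "f \<in> O[step_filter t0 T H](\<lambda>x. fst x ^ k)"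
  shows "\<exists>C>0. \<exists>h0\<in>{0<..H}. \<forall>h\<in>{0<..h0}. \<forall>n. grid t0 h (n + 1) \<le> T \<longrightarrow> \<bar>f (h, n)\<bar> \<le> C * h ^ k"
proof -
  obtain C where "C > 0" "\<forall>\<^sub>F x in step_filter t0 T H. norm (f x) \<le> C * norm (fst x ^ k)"
    using assms(2) by (auto elim!: landau_o.bigE)
  moreover from this obtain h0 where "h0 \<in> {0<..H}"
    "\<forall>h\<in>{0<..h0}. \<forall>n<num_steps t0 T h. norm (f (h, n)) \<le> C * norm (h ^ k)"
    using assms(1) by (auto simp: eventually_step_filter)
  ultimately show ?thesis
    by (intro exI[of _ C] conjI bexI[of _ h0]) (auto simp: less_num_steps_iff abs_of_pos)
qed

text \<open>The modulus has to exist on all of \<open>{0<..H}\<close>, not only near 0. For each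
  \<open>h\<close> there are finitely many steps, so the largest normalised remainder is a finite
  choice, and the little-o bound, uniform in the index, makes it tend to 0.\<close>

lemma step_filter_smalloD:
  assumes "H > 0" and f: "f \<in> o[step_filter t0 T H](\<lambda>x. fst x ^ k)"
  shows "\<exists>\<omega>::real \<Rightarrow> real. (\<forall>h\<in>{0<..H}. 0 \<le> \<omega> h) \<and> (\<omega> \<longlongrightarrow> 0) (at_right 0) \<and>
    (\<forall>h\<in>{0<..H}. \<forall>n. grid t0 h (n + 1) \<le> T \<longrightarrow> \<bar>f (h, n)\<bar> \<le> \<omega> h * h ^ k)"
proof (intro exI conjI ballI allI impI)
  \<comment> \<open>Inserting 0 gives nonnegativity and keeps the set nonempty when no step fits
    into the interval.\<close>
  define \<omega> where "\<omega> h = Max (insert 0 ((\<lambda>n. \<bar>f (h, n)\<bar> / h ^ k) ` {..<num_steps t0 T h}))" for h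
  show nonneg: "0 \<le> \<omega> h" for h
    unfolding \<omega>_def by (intro Max_ge) auto
  show "(\<omega> \<longlongrightarrow> 0) (at_right 0)"
  proof (rule tendstoI)
    fix e :: real
    assume "e > 0"
    then have "\<forall>\<^sub>F x in step_filter t0 T H. norm (f x) \<le> e / 2 * norm (fst x ^ k)"
      using landau_o.smallD[OF f, of "e / 2"] by simp
    then obtain h0 where h0: "h0 > 0"
      "\<And>h n. h \<in> {0<..h0} \<Longrightarrow> n < num_steps t0 T h \<Longrightarrow> norm (f (h, n)) \<le> e / 2 * norm (h ^ k)"
      using assms(1) by (auto simp: eventually_step_filter)
    have "dist (\<omega> h) 0 < e" if "0 < h" "h < h0" for h
    proof -
      have "\<omega> h \<le> e / 2"
        unfolding \<omega>_def using \<open>e > 0\<close> that h0(2)[of h]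
        by (subst Max_le_iff) (auto simp: pos_divide_le_eq)
      then show ?thesis
        using \<open>e > 0\<close> nonneg[of h] by (simp add: dist_real_def)
    qed
    then show "\<forall>\<^sub>F h in at_right 0. dist (\<omega> h) 0 < e"
      using h0(1) by (auto simp: eventually_at_right_field intro!: exI[of _ h0])
  qed
  fix h n
  assume h: "h \<in> {0<..H}" and "grid t0 h (n + 1) \<le> T"
  then have "n < num_steps t0 T h"
    by (subst less_num_steps_iff) auto
  then have "\<bar>f (h, n)\<bar> / h ^ k \<le> \<omega> h"
    unfolding \<omega>_def by (intro Max_ge) auto
  then show "\<bar>f (h, n)\<bar> \<le> \<omega> h * h ^ k"
    using h by (simp add: pos_divide_le_eq)
qed

section \<open>Expansion of the local truncation error\<close>

locale uniform_steps =
  fixes t0 T H :: real and u :: "real \<Rightarrow> real"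
  assumes t0_less_T: "t0 < T" and H_pos: "0 < H"
begin

abbreviation D :: "nat \<Rightarrow> real \<Rightarrow> real" where
  "D i \<equiv> (deriv_within {t0..T} ^^ i) u"

abbreviation steps :: "(real \<times> nat) filter" where
  "steps \<equiv> step_filter t0 T H"

abbreviation left :: "real \<times> nat \<Rightarrow> real" where
  "left x \<equiv> grid t0 (fst x) (snd x)"

abbreviation right :: "real \<times> nat \<Rightarrow> real" where
  "right x \<equiv> grid t0 (fst x) (snd x + 1)"

lemma eventually_stepsI:
  assumes "\<And>x. fst x \<in> {0<..H} \<Longrightarrow> snd x < num_steps t0 T (fst x) \<Longrightarrow> P x"
  shows "eventually P steps"
  unfolding eventually_step_filter[OF H_pos] using H_pos by (auto intro!: bexI[of _ H] assms)

lemma grid_mem: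
  assumes "h > 0" and "n < num_steps t0 T h"
  shows "grid t0 h n \<in> {t0..T}" and "grid t0 h (n + 1) \<in> {t0..T}"
proof -
  have "grid t0 h (n + 1) \<le> T"
    using assms by (simp only: less_num_steps_iff)
  moreover have "0 \<le> real n * h"
    using assms by simp
  ultimately show "grid t0 h n \<in> {t0..T}" and "grid t0 h (n + 1) \<in> {t0..T}"
    using assms by (auto simp: grid_def algebra_simps)
qed

lemma eventually_left: "eventually (\<lambda>x. left x \<in> {t0..T}) steps"
  and eventually_right: "eventually (\<lambda>x. right x \<in> {t0..T}) steps"
  by (rule eventually_stepsI, rule grid_mem, simp, assumption)+

lemma right_diff_left: "right x - left x = fst x"
  by (simp add: grid_def algebra_simps)

lemma eventually_step_pos: "eventually (\<lambda>x. 0 < fst x) steps"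
  by (rule eventually_stepsI) simp

lemma tendsto_step: "(fst \<longlongrightarrow> 0) steps"
proof (rule tendstoI)
  fix e :: real
  assume "e > 0"
  then show "\<forall>\<^sub>F x in steps. dist (fst x) 0 < e"
    unfolding eventually_step_filter[OF H_pos] using H_pos
    by (auto intro!: bexI[of _ "min (e / 2) H"])
qed

lemma step_smallo: "fst \<in> o[steps](\<lambda>_. 1)"
  by (rule smalloI_tendsto) (use tendsto_step in simp_all)

lemma step_bigo: "fst \<in> O[steps](\<lambda>_. 1)"
  by (rule landau_o.small_imp_big[OF step_smallo])

lemma bigo_left:
  assumes "C_k_on k {t0..T} u" and "i \<le> k"
  shows "(\<lambda>x. D i (left x)) \<in> O[steps](\<lambda>_. 1)"
  by (rule continuous_on_interval_bigo[OF C_k_on_continuous_on[OF assms] eventually_left])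

lemma bigo_right:
  assumes "C_k_on k {t0..T} u" and "i \<le> k"
  shows "(\<lambda>x. D i (right x)) \<in> O[steps](\<lambda>_. 1)"
  by (rule continuous_on_interval_bigo[OF C_k_on_continuous_on[OF assms] eventually_right])

section \<open>Taylor remainders and the trapezoidal rule along the grid\<close>

definition taylor_rest :: "nat \<Rightarrow> nat \<Rightarrow> real \<times> nat \<Rightarrow> real" where
  "taylor_rest i m x = D i (right x) - (\<Sum>j\<le>m. D (i + j) (left x) * fst x ^ j / fact j)"

lemma taylor_rest_bigo:
  assumes u: "C_k_on k {t0..T} u" and "i + m < k"
  shows "taylor_rest i m \<in> O[steps](\<lambda>x. fst x ^ Suc m)"
proof -
  have "(D (i + j) has_real_derivative D (i + Suc j) y) (at y within {t0..T})"
    if "j \<le> m" "y \<in> {t0..T}" for j y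
    using C_k_on_has_real_derivative[OF u, of "i + j" y] that assms(2) by simp
  moreover have "continuous_on {t0..T} (D (i + Suc m))"
    using assms(2) by (intro C_k_on_continuous_on[OF u]) simp
  ultimately show ?thesis
    using taylor_bigo[of m t0 T "\<lambda>j. D (i + j)", OF _ _ eventually_left eventually_right]
    by (simp only: taylor_rest_def[abs_def] right_diff_left add_0_right)
qed

text \<open>Under the same smoothness as in \<open>taylor_rest_bigo\<close> the polynomial takes one
  more term, at the price of a little-o remainder.\<close>

lemma taylor_rest_smallo:
  assumes u: "C_k_on k {t0..T} u" and "i + m < k"
  shows "taylor_rest i (Suc m) \<in> o[steps](\<lambda>x. fst x ^ Suc m)"
proof -
  have "(D (i + j) has_real_derivative D (i + Suc j) y) (at y within {t0..T})"
    if "j \<le> m" "y \<in> {t0..T}" for j y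
    using C_k_on_has_real_derivative[OF u, of "i + j" y] that assms(2) by simp
  moreover have "continuous_on {t0..T} (D (i + Suc m))"
    using assms(2) by (intro C_k_on_continuous_on[OF u]) simp
  moreover have "((\<lambda>x. right x - left x) \<longlongrightarrow> 0) steps"
    using tendsto_step by (simp only: right_diff_left)
  ultimately show ?thesis
    using taylor_smallo[of m t0 T "\<lambda>j. D (i + j)", OF _ _ eventually_left eventually_right]
    by (simp only: taylor_rest_def[abs_def] right_diff_left add_0_right)
qed

definition trapezoid_error :: "real \<times> nat \<Rightarrow> real" where
  "trapezoid_error x = (u (right x) - u (left x)) / fst x - (D 1 (right x) + D 1 (left x)) / 2"

lemma step_divide_bigo:
  "f \<in> O[steps](\<lambda>x. fst x ^ Suc k) \<Longrightarrow> (\<lambda>x. f x / fst x) \<in> O[steps](\<lambda>x. fst x ^ k)"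
  using eventually_step_pos
  by (subst landau_o.big.divide_eq2) (auto simp: mult.commute elim: eventually_mono)

lemma step_divide_smallo:
  "f \<in> o[steps](\<lambda>x. fst x ^ Suc k) \<Longrightarrow> (\<lambda>x. f x / fst x) \<in> o[steps](\<lambda>x. fst x ^ k)"
  using eventually_step_pos
  by (subst landau_o.small.divide_eq2) (auto simp: mult.commute elim: eventually_mono)

text \<open>The third derivative enters with 1/6 from \<open>u\<close> and with 1/4 from the mean of
  the first derivatives, and 1/6 - 1/4 = -1/12.\<close>

lemma trapezoid_error_taylor:
  "eventually (\<lambda>x. trapezoid_error x + fst x ^ 2 / 12 * D 3 (left x) =
    taylor_rest 0 3 x / fst x - taylor_rest 1 2 x / 2) steps"
  using eventually_step_pos
  by eventually_elim
    (simp add: trapezoid_error_def taylor_rest_def eval_nat_numeral fact_numeral field_simps)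

lemma trapezoid_error_smallo:
  assumes "C_k_on 3 {t0..T} u"
  shows "(\<lambda>x. trapezoid_error x + fst x ^ 2 / 12 * D 3 (left x)) \<in> o[steps](\<lambda>x. fst x ^ 2)"
proof -
  have "taylor_rest 0 3 \<in> o[steps](\<lambda>x. fst x ^ Suc 2)" "taylor_rest 1 2 \<in> o[steps](\<lambda>x. fst x ^ 2)"
    using taylor_rest_smallo[OF assms, of 0 2] taylor_rest_smallo[OF assms, of 1 1]
    by (simp_all add: numeral_eq_Suc)
  then have "(\<lambda>x. taylor_rest 0 3 x / fst x - taylor_rest 1 2 x / 2) \<in> o[steps](\<lambda>x. fst x ^ 2)"
    by (intro sum_in_smallo step_divide_smallo) simp_all
  then show ?thesis
    by (subst landau_o.small.in_cong[OF trapezoid_error_taylor])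
qed

lemma trapezoid_error_bigo:
  assumes "C_k_on 4 {t0..T} u"
  shows "(\<lambda>x. trapezoid_error x + fst x ^ 2 / 12 * D 3 (left x)) \<in> O[steps](\<lambda>x. fst x ^ 3)"
proof -
  have "taylor_rest 0 3 \<in> O[steps](\<lambda>x. fst x ^ Suc 3)" "taylor_rest 1 2 \<in> O[steps](\<lambda>x. fst x ^ 3)"
    using taylor_rest_bigo[OF assms, of 0 3] taylor_rest_bigo[OF assms, of 1 2]
    by (simp_all add: numeral_eq_Suc)
  then have "(\<lambda>x. taylor_rest 0 3 x / fst x - taylor_rest 1 2 x / 2) \<in> O[steps](\<lambda>x. fst x ^ 3)"
    by (intro sum_in_bigo step_divide_bigo) simp_all
  then show ?thesis
    by (subst landau_o.big.in_cong[OF trapezoid_error_taylor])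
qed

text \<open>The fourth derivative enters the trapezoidal error with
  \<open>h^3 (1/24 - 1/12) = - h^3 / 24\<close>. Averaging the third derivative over both ends
  contributes \<open>+ h^3 / 24\<close>, so the cubic term cancels.\<close>

lemma trapezoid_error_symmetric_bigo:
  assumes "C_k_on 5 {t0..T} u"
  shows "(\<lambda>x. trapezoid_error x + fst x ^ 2 / 24 * (D 3 (left x) + D 3 (right x))) \<in> O[steps](\<lambda>x. fst x ^ 4)"
proof -
  have "taylor_rest 0 4 \<in> O[steps](\<lambda>x. fst x ^ Suc 4)" "taylor_rest 1 3 \<in> O[steps](\<lambda>x. fst x ^ 4)"
    and r3: "taylor_rest 3 1 \<in> O[steps](\<lambda>x. fst x ^ 2)"
    using taylor_rest_bigo[OF assms, of 0 4] taylor_rest_bigo[OF assms, of 1 3] taylor_rest_bigo[OF assms, of 3 1]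
    by (simp_all add: numeral_eq_Suc)
  moreover have "(\<lambda>x. fst x ^ 2 * taylor_rest 3 1 x) \<in> O[steps](\<lambda>x. fst x ^ 4)"
    by (rule bigo_power_mult[OF landau_o.big_refl r3]) simp
  ultimately have "(\<lambda>x. taylor_rest 0 4 x / fst x - taylor_rest 1 3 x / 2 + fst x ^ 2 * taylor_rest 3 1 x / 24)
      \<in> O[steps](\<lambda>x. fst x ^ 4)"
    by (intro sum_in_bigo step_divide_bigo) simp_all
  moreover have "eventually (\<lambda>x. trapezoid_error x + fst x ^ 2 / 24 * (D 3 (left x) + D 3 (right x)) =
      taylor_rest 0 4 x / fst x - taylor_rest 1 3 x / 2 + fst x ^ 2 * taylor_rest 3 1 x / 24) steps"
    using eventually_step_pos
    by eventually_elim
      (simp add: trapezoid_error_def taylor_rest_def eval_nat_numeral fact_numeral field_simps)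
  ultimately show ?thesis
    by (subst landau_o.big.in_cong)
qed

lemma first_derivative_step:
  assumes "C_k_on 3 {t0..T} u"
  shows "(\<lambda>x. D 1 (right x) - D 1 (left x) - fst x * D 2 (left x)) \<in> O[steps](\<lambda>x. fst x ^ 2)"
  using taylor_rest_bigo[OF assms, of 1 1]
  by (simp add: taylor_rest_def[abs_def] numeral_2_eq_2 algebra_simps)

text \<open>The third derivative cancels between the expansions of the first and of the second
  derivative; the result has the form of premise \<open>dm\<close> of
  \<open>chord_defect_symmetric_expansion\<close>.\<close>

lemma first_derivative_step_symmetric:
  assumes "C_k_on 4 {t0..T} u"
  shows "(\<lambda>x. D 1 (right x) - D 1 (left x) - fst x * ((D 2 (left x) + D 2 (right x)) / 2)) \<in> O[steps](\<lambda>x. fst x ^ 3)"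
proof -
  have "taylor_rest 1 2 \<in> O[steps](\<lambda>x. fst x ^ 3)" and r2: "taylor_rest 2 1 \<in> O[steps](\<lambda>x. fst x ^ 2)"
    using taylor_rest_bigo[OF assms, of 1 2] taylor_rest_bigo[OF assms, of 2 1]
    by (simp_all add: numeral_eq_Suc)
  moreover have "(\<lambda>x. fst x ^ 1 * taylor_rest 2 1 x) \<in> O[steps](\<lambda>x. fst x ^ 3)"
    by (rule bigo_power_mult[OF landau_o.big_refl r2]) simp
  ultimately have "(\<lambda>x. taylor_rest 1 2 x - fst x * taylor_rest 2 1 x / 2) \<in> O[steps](\<lambda>x. fst x ^ 3)"
    by (intro sum_in_bigo) simp_all
  moreover have "(\<lambda>x. taylor_rest 1 2 x - fst x * taylor_rest 2 1 x / 2) =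
      (\<lambda>x. D 1 (right x) - D 1 (left x) - fst x * ((D 2 (left x) + D 2 (right x)) / 2))"
    by (simp add: fun_eq_iff taylor_rest_def eval_nat_numeral field_simps)
  ultimately show ?thesis by simp
qed

lemma derivative_step:
  assumes "C_k_on k {t0..T} u" and "i < k"
  shows "(\<lambda>x. D i (right x) - D i (left x)) \<in> O[steps](fst)"
  using taylor_rest_bigo[OF assms(1), of i 0] assms(2) by (simp add: taylor_rest_def[abs_def])

end

section \<open>The local truncation error for a family of scales\<close>

locale scaled_ivp_steps = uniform_steps +
  fixes F :: "real \<times> real \<Rightarrow> real" and \<sigma> :: "real \<Rightarrow> nat \<Rightarrow> real" and \<eta> :: real
  \<comment> \<open>The equation is required on the closed interval because the first and last grid
    points can be endpoints. The smoothness of \<open>u\<close> is left to the single lemmas, so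
    that one locale serves all three orders.\<close>
  assumes ode: "\<And>t. t \<in> {t0..T} \<Longrightarrow> F (t, u t) = deriv_within {t0..T} u t"
    and eta_pos: "0 < \<eta>"
    and scale_pos: "\<And>h n. h \<in> {0<..H} \<Longrightarrow> n < num_steps t0 T h \<Longrightarrow> 0 < \<sigma> h n"
    and scale_bound: "\<And>h n. h \<in> {0<..H} \<Longrightarrow> n < num_steps t0 T h \<Longrightarrow>
           \<eta> \<le> (\<sigma> h n)\<^sup>2 + (deriv_within {t0..T} u (grid t0 h n))\<^sup>2"
begin

abbreviation scale :: "real \<times> nat \<Rightarrow> real" where
  "scale x \<equiv> \<sigma> (fst x) (snd x)"

abbreviation err :: "real \<times> nat \<Rightarrow> real" where
  "err x \<equiv> local_trunc_err F u t0 (fst x) (scale x) (snd x)"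

abbreviation speed :: "real \<times> nat \<Rightarrow> real \<Rightarrow> real" where
  "speed x t \<equiv> curve_speed t0 T u (scale x) t"

abbreviation curv' :: "real \<times> nat \<Rightarrow> real \<Rightarrow> real" where
  "curv' x t \<equiv> curvature_deriv t0 T u (scale x) t"

abbreviation defect :: "real \<times> nat \<Rightarrow> real" where
  "defect x \<equiv> chord_defect (scale x) (D 1 (right x)) (D 1 (left x))"

lemma err_eq:
  assumes "fst x \<in> {0<..H}" and "snd x < num_steps t0 T (fst x)"
  shows "err x = trapezoid_error x + defect x"
proof -
  have "left x \<in> {t0..T}" "right x \<in> {t0..T}"
    using assms by (intro grid_mem; simp)+
  then show ?thesis
    unfolding local_trunc_err_def spec_C_scaled_eq[OF scale_pos[OF assms]]
    by (simp only: ode) (simp add: trapezoid_error_def chord_defect_def)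
qed

lemma eventually_scale_bound: "eventually (\<lambda>x. \<eta> \<le> (scale x)\<^sup>2 + (D 1 (left x))\<^sup>2) steps"
  by (rule eventually_stepsI) (use scale_bound in simp)

text \<open>The lower bound \<open>\<eta>\<close> is given at left grid points only. Passing to the
  right one changes the squared derivative by a product of order \<open>h\<close>, which is
  eventually at most \<open>\<eta> / 2\<close>.\<close>

lemma eventually_scale_bound_right:
  assumes u: "C_k_on 3 {t0..T} u"
  shows "eventually (\<lambda>x. \<eta> / 2 \<le> (scale x)\<^sup>2 + (D 1 (right x))\<^sup>2) steps"
proof -
  have "(\<lambda>x. (D 1 (right x) - D 1 (left x)) * (D 1 (right x) + D 1 (left x))) \<in> O[steps](fst)"
    by (intro landau_o.big_1_mult derivative_step[OF u] sum_in_bigo bigo_left[OF u] bigo_right[OF u]) auto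
  from landau_o.big_small_trans[OF this step_smallo]
  have "\<forall>\<^sub>F x in steps. \<bar>(D 1 (right x) - D 1 (left x)) * (D 1 (right x) + D 1 (left x))\<bar> \<le> \<eta> / 2"
    using landau_o.smallD[where c = "\<eta> / 2"] eta_pos by fastforce
  with eventually_scale_bound show ?thesis
    by eventually_elim (simp add: algebra_simps power2_eq_square abs_if split: if_splits)
qed

definition err_main :: "real \<times> nat \<Rightarrow> real" where
  "err_main x = - ((fst x)\<^sup>2 / 12) * scale x * speed x (left x) ^ 3 * curv' x (left x)"

definition err_main_symmetric :: "real \<times> nat \<Rightarrow> real" where
  "err_main_symmetric x = - ((fst x)\<^sup>2 / 24) * scale x *
     (speed x (left x) ^ 3 * curv' x (left x) + speed x (right x) ^ 3 * curv' x (right x))"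

text \<open>By \<open>speed_cubed_curvature_deriv\<close> the main term supplies the third
  derivative to the trapezoidal error and the quotient to the defect, the latter with 3/12 =
  1/4.\<close>

lemma err_remainder_eq:
  assumes u: "C_k_on 3 {t0..T} u"
  shows "eventually (\<lambda>x. err x - err_main x =
    (trapezoid_error x + fst x ^ 2 / 12 * D 3 (left x)) +
    (defect x - fst x ^ 2 * (D 1 (left x) * (D 2 (left x))\<^sup>2 / (4 * ((scale x)\<^sup>2 + (D 1 (left x))\<^sup>2))))) steps"
proof (rule eventually_stepsI)
  fix x :: "real \<times> nat"
  assume x: "fst x \<in> {0<..H}" "snd x < num_steps t0 T (fst x)"
  have "left x \<in> {t0..T}"
    using x by (intro grid_mem) auto
  note G = speed_cubed_curvature_deriv[OF t0_less_T u this scale_pos[OF x]]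
  have "err_main x = - ((fst x)\<^sup>2 / 12) * (scale x * speed x (left x) ^ 3 * curv' x (left x))"
    by (simp add: err_main_def)
  then show "err x - err_main x =
    (trapezoid_error x + fst x ^ 2 / 12 * D 3 (left x)) +
    (defect x - fst x ^ 2 * (D 1 (left x) * (D 2 (left x))\<^sup>2 / (4 * ((scale x)\<^sup>2 + (D 1 (left x))\<^sup>2))))"
    unfolding G err_eq[OF x] by (simp add: algebra_simps)
qed

text \<open>The curvature identity is used at both ends with the same scale, and the quotients
  receive the factor 3/24 = 1/8.\<close>

lemma err_remainder_symmetric_eq:
  assumes u: "C_k_on 3 {t0..T} u"
  shows "eventually (\<lambda>x. err x - err_main_symmetric x =
    (trapezoid_error x + fst x ^ 2 / 24 * (D 3 (left x) + D 3 (right x))) +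
    (defect x - fst x ^ 2 / 8 * (D 1 (left x) * (D 2 (left x))\<^sup>2 / ((scale x)\<^sup>2 + (D 1 (left x))\<^sup>2)
      + D 1 (right x) * (D 2 (right x))\<^sup>2 / ((scale x)\<^sup>2 + (D 1 (right x))\<^sup>2)))) steps"
proof (rule eventually_stepsI)
  fix x :: "real \<times> nat"
  assume x: "fst x \<in> {0<..H}" "snd x < num_steps t0 T (fst x)"
  have "left x \<in> {t0..T}" "right x \<in> {t0..T}"
    using x by (intro grid_mem; simp)+
  note G = this[THEN speed_cubed_curvature_deriv[OF t0_less_T u _ scale_pos[OF x]]]
  have "err_main_symmetric x = - ((fst x)\<^sup>2 / 24) *
      (scale x * speed x (left x) ^ 3 * curv' x (left x) + scale x * speed x (right x) ^ 3 * curv' x (right x))"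
    by (simp only: err_main_symmetric_def distrib_left mult.assoc)
  then show "err x - err_main_symmetric x =
    (trapezoid_error x + fst x ^ 2 / 24 * (D 3 (left x) + D 3 (right x))) +
    (defect x - fst x ^ 2 / 8 * (D 1 (left x) * (D 2 (left x))\<^sup>2 / ((scale x)\<^sup>2 + (D 1 (left x))\<^sup>2)
      + D 1 (right x) * (D 2 (right x))\<^sup>2 / ((scale x)\<^sup>2 + (D 1 (right x))\<^sup>2)))"
    unfolding G err_eq[OF x] by (simp add: algebra_simps)
qed

lemma defect_expansion:
  assumes u: "C_k_on 3 {t0..T} u"
  shows "(\<lambda>x. defect x - fst x ^ 2 * (D 1 (left x) * (D 2 (left x))\<^sup>2 / (4 * ((scale x)\<^sup>2 + (D 1 (left x))\<^sup>2))))
    \<in> O[steps](\<lambda>x. fst x ^ 3)"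
  by (rule chord_defect_expansion[OF eta_pos eventually_scale_bound bigo_left[OF u] bigo_left[OF u]
        step_bigo first_derivative_step[OF u]]) auto

text \<open>Three derivatives already give the defect to order \<open>h^3\<close>; only the
  trapezoidal part limits the remainder to little-o of \<open>h^2\<close>.\<close>

lemma err_smallo:
  assumes u: "C_k_on 3 {t0..T} u"
  shows "(\<lambda>x. err x - err_main x) \<in> o[steps](\<lambda>x. fst x ^ 2)"
proof -
  have "(\<lambda>x. fst x ^ 3) \<in> o[steps](\<lambda>x. fst x ^ 2)"
    using landau_o.big_small_mult[OF landau_o.big_refl[of "\<lambda>x. fst x ^ 2"] step_smallo]
    by (simp add: eval_nat_numeral mult.commute)
  from sum_in_smallo(1)[OF trapezoid_error_smallo[OF u] landau_o.big_small_trans[OF defect_expansion[OF u] this]]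
  show ?thesis
    by (subst landau_o.small.in_cong[OF err_remainder_eq[OF u]])
qed

lemma err_bigo:
  assumes u: "C_k_on 4 {t0..T} u"
  shows "(\<lambda>x. err x - err_main x) \<in> O[steps](\<lambda>x. fst x ^ 3)"
proof -
  have u3: "C_k_on 3 {t0..T} u"
    using u by (rule C_k_on_mono) simp
  show ?thesis
    using sum_in_bigo(1)[OF trapezoid_error_bigo[OF u] defect_expansion[OF u3]]
    by (subst landau_o.big.in_cong[OF err_remainder_eq[OF u3]])
qed

lemma err_symmetric_bigo:
  assumes u: "C_k_on 5 {t0..T} u"
  shows "(\<lambda>x. err x - err_main_symmetric x) \<in> O[steps](\<lambda>x. fst x ^ 4)"
proof -
  have u4: "C_k_on 4 {t0..T} u" and u3: "C_k_on 3 {t0..T} u"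
    using u by (auto intro: C_k_on_mono)
  \<comment> \<open>The symmetric expansion takes one lower bound for both ends, so the left one is
    weakened to match the right.\<close>
  have "eventually (\<lambda>x. \<eta> / 2 \<le> (scale x)\<^sup>2 + (D 1 (left x))\<^sup>2) steps"
    using eventually_scale_bound by eventually_elim (use eta_pos in linarith)
  then have "(\<lambda>x. defect x - fst x ^ 2 / 8 * (D 1 (left x) * (D 2 (left x))\<^sup>2 / ((scale x)\<^sup>2 + (D 1 (left x))\<^sup>2)
      + D 1 (right x) * (D 2 (right x))\<^sup>2 / ((scale x)\<^sup>2 + (D 1 (right x))\<^sup>2))) \<in> O[steps](\<lambda>x. fst x ^ 4)"
    by (rule chord_defect_symmetric_expansion[OF _ _ eventually_scale_bound_right[OF u3]
          bigo_left[OF u] bigo_right[OF u] bigo_left[OF u] bigo_right[OF u]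
          step_bigo derivative_step[OF u] first_derivative_step_symmetric[OF u4], rotated])
      (use eta_pos in auto)
  from sum_in_bigo(1)[OF trapezoid_error_symmetric_bigo[OF u] this] show ?thesis
    by (subst landau_o.big.in_cong[OF err_remainder_symmetric_eq[OF u3]])
qed

end

section \<open>The differential equation up to the endpoints, and the three expansions\<close>

lemma C_k_plane_imp_continuous_on: "C_k_plane k \<Omega> F \<Longrightarrow> continuous_on \<Omega> F"
  by (cases k) auto

text \<open>At the endpoints the equation holds for the one-sided derivative because both sides are continuous.\<close>

lemma ivp_solution_deriv_within:
  assumes "t0 < T" and F: "continuous_on \<Omega> F" and sol: "ivp_solution \<Omega> F t0 T u0 u"
    and u: "C_k_on k {t0..T} u" and "1 \<le> k" and t: "t \<in> {t0..T}"
  shows "F (t, u t) = deriv_within {t0..T} u t"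
proof -
  have "continuous_on {t0..T} (\<lambda>t. F (t, u t))"
    using sol by (intro continuous_on_compose2[OF F] continuous_on_Pair continuous_on_id)
      (auto simp: ivp_solution_def)
  moreover have "continuous_on {t0..T} (deriv_within {t0..T} u)"
    using C_k_on_continuous_on[OF u \<open>1 \<le> k\<close>] by simp
  ultimately have "continuous_on (closure {t0<..<T}) (\<lambda>t. F (t, u t) - deriv_within {t0..T} u t)"
    using \<open>t0 < T\<close> by (simp add: continuous_on_diff)
  moreover have "F (s, u s) - deriv_within {t0..T} u s = 0" if "s \<in> {t0<..<T}" for s
  proof -
    have "(u has_real_derivative F (s, u s)) (at s within {t0..T})"
      using sol that by (auto simp: ivp_solution_def intro: has_field_derivative_at_within)
    then have "deriv_within {t0..T} u s = F (s, u s)"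
      using that by (intro deriv_within_eq[OF \<open>t0 < T\<close>]) (auto simp: has_real_derivative_iff_has_vector_derivative)
    then show ?thesis by simp
  qed
  moreover have "t \<in> closure {t0<..<T}"
    using t \<open>t0 < T\<close> by simp
  ultimately have "F (t, u t) - deriv_within {t0..T} u t = 0"
    by (rule continuous_constant_on_closure)
  then show ?thesis by simp
qed

theorem theorem4p2:
  fixes \<Omega> :: "(real \<times> real) set" and F :: "real \<times> real \<Rightarrow> real"
    and t0 T u0 H \<eta> :: real and u :: "real \<Rightarrow> real"
    and \<sigma> :: "real \<Rightarrow> nat \<Rightarrow> real"
  assumes "open \<Omega>" and "0 \<le> t0" and "t0 < T" and "(t0, u0) \<in> \<Omega>"
    and "C_k_plane 2 \<Omega> F"
    and "ivp_solution \<Omega> F t0 T u0 u"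
    and "0 < H" and "0 < \<eta>"
    and "\<And>h n. h \<in> {0<..H} \<Longrightarrow> n < num_steps t0 T h \<Longrightarrow> 0 < \<sigma> h n"
    and "\<And>h n. h \<in> {0<..H} \<Longrightarrow> n < num_steps t0 T h \<Longrightarrow>
           \<eta> \<le> (\<sigma> h n)\<^sup>2 + (deriv_within {t0..T} u (grid t0 h n))\<^sup>2"
  shows
    "(C_k_on 3 {t0..T} u \<longrightarrow>
       (\<exists>R :: real \<Rightarrow> nat \<Rightarrow> real.
          (\<forall>h\<in>{0<..H}. \<forall>n<num_steps t0 T h.
             local_trunc_err F u t0 h (\<sigma> h n) n =
               - (h\<^sup>2 / 12) * \<sigma> h n * (curve_speed t0 T u (\<sigma> h n) (grid t0 h n)) ^ 3
                 * curvature_deriv t0 T u (\<sigma> h n) (grid t0 h n)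
               + R h (n + 1)) \<and>
          (\<exists>\<omega> :: real \<Rightarrow> real.
             (\<forall>h\<in>{0<..H}. 0 \<le> \<omega> h) \<and> (\<omega> \<longlongrightarrow> 0) (at_right 0) \<and>
             (\<forall>h\<in>{0<..H}. \<forall>n. grid t0 h (n + 1) \<le> T \<longrightarrow> \<bar>R h (n + 1)\<bar> \<le> \<omega> h * h\<^sup>2))))
     \<and>
     (C_k_on 4 {t0..T} u \<longrightarrow>
       (\<exists>R :: real \<Rightarrow> nat \<Rightarrow> real.
          (\<forall>h\<in>{0<..H}. \<forall>n<num_steps t0 T h.
             local_trunc_err F u t0 h (\<sigma> h n) n =
               - (h\<^sup>2 / 12) * \<sigma> h n * (curve_speed t0 T u (\<sigma> h n) (grid t0 h n)) ^ 3
                 * curvature_deriv t0 T u (\<sigma> h n) (grid t0 h n)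
               + R h (n + 1)) \<and>
          (\<exists>C>0. \<exists>h0\<in>{0<..H}. \<forall>h\<in>{0<..h0}. \<forall>n.
             grid t0 h (n + 1) \<le> T \<longrightarrow> \<bar>R h (n + 1)\<bar> \<le> C * h ^ 3)))
     \<and>
     (C_k_on 5 {t0..T} u \<longrightarrow>
       (\<exists>R :: real \<Rightarrow> nat \<Rightarrow> real.
          (\<forall>h\<in>{0<..H}. \<forall>n<num_steps t0 T h.
             local_trunc_err F u t0 h (\<sigma> h n) n =
               - (h\<^sup>2 / 24) * \<sigma> h n *
                 ((curve_speed t0 T u (\<sigma> h n) (grid t0 h n)) ^ 3
                    * curvature_deriv t0 T u (\<sigma> h n) (grid t0 h n)
                  + (curve_speed t0 T u (\<sigma> h n) (grid t0 h (n + 1))) ^ 3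
                    * curvature_deriv t0 T u (\<sigma> h n) (grid t0 h (n + 1)))
               + R h (n + 1)) \<and>
          (\<exists>C>0. \<exists>h0\<in>{0<..H}. \<forall>h\<in>{0<..h0}. \<forall>n.
             grid t0 h (n + 1) \<le> T \<longrightarrow> \<bar>R h (n + 1)\<bar> \<le> C * h ^ 4)))"
proof -
  have F: "continuous_on \<Omega> F"
    using assms(5) by (rule C_k_plane_imp_continuous_on)
  have steps: "scaled_ivp_steps t0 T H u F \<sigma> \<eta>" if "C_k_on k {t0..T} u" "1 \<le> k" for k
    using assms(3,7-10) ivp_solution_deriv_within[OF assms(3) F assms(6) that]
    by unfold_locales auto
  show ?thesis (is "(_ \<longrightarrow> ?a) \<and> (_ \<longrightarrow> ?b) \<and> (_ \<longrightarrow> ?c)")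
  proof (intro conjI impI)
    assume u: "C_k_on 3 {t0..T} u"
    then interpret scaled_ivp_steps t0 T H u F \<sigma> \<eta>
      by (rule steps) simp
    \<comment> \<open>In all three parts \<open>R\<close> is the error minus the main term. Its
      index is \<open>n + 1\<close>, whereas \<open>err\<close> is indexed by the left grid point,
      hence \<open>m - 1\<close>; the value at \<open>m = 0\<close> never occurs.\<close>
    show ?a
      using step_filter_smalloD[OF assms(7) err_smallo[OF u]]
      by (intro exI[of _ "\<lambda>h m. err (h, m - 1) - err_main (h, m - 1)"]) (simp add: err_main_def)
  next
    assume u: "C_k_on 4 {t0..T} u"
    then interpret scaled_ivp_steps t0 T H u F \<sigma> \<eta>
      by (rule steps) simp
    from step_filter_bigoD[OF assms(7) err_bigo[OF u]] show ?b
      by (intro exI[of _ "\<lambda>h m. err (h, m - 1) - err_main (h, m - 1)"]) (simp add: err_main_def)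
  next
    assume u: "C_k_on 5 {t0..T} u"
    then interpret scaled_ivp_steps t0 T H u F \<sigma> \<eta>
      by (rule steps) simp
    from step_filter_bigoD[OF assms(7) err_symmetric_bigo[OF u]] show ?c
      by (intro exI[of _ "\<lambda>h m. err (h, m - 1) - err_main_symmetric (h, m - 1)"])
        (simp add: err_main_symmetric_def)
  qed
qed

end
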